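(* Let $b>1$ be fixed and $\beta = \arcsin(1/b)$. As real $x\to +\infty$, $I(b,x)$ has an asymptotic expansion whose first three terms are given by \begin{align*} I(b,x)=&\frac{2}{\sqrt{2\pi}}\frac{(b^2-1)^{1/4}}{x^{1/2}}\cos(x\beta-\pi/4) +\frac{(b^2+2)}{4\sqrt{2\pi}}\frac{(b^2-1)^{-1/4}}{x^{3/2}}\sin(x\beta-\pi/4)\\ &-\frac{(9b^4-28b^2+4)}{64\sqrt{2\pi}}\frac{(b^2-1)^{-3/4}}{x^{5/2}}\cos(x\beta-\pi/4)+ O\left(\frac{1}{x^{7/2}}\right). \end{align*}
   Context: For real $b>1$ and real $x$ let \[I(b,x) := \frac{1}{2\pi}\int_0^{2\pi}\exp\left(-ix \arg(1-b^{-1}e^{i\theta})\right)d\theta,\] where $\arg$ denotes the principal argument. *)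

theory Defs
  imports "HOL-Analysis.Analysis" "HOL-Library.Landau_Symbols"
begin

definition arg_integral :: "real \<Rightarrow> real \<Rightarrow> complex" where
  "arg_integral b x =
     1 / (2 * of_real pi) *
     integral {0..2*pi}
       (\<lambda>\<theta>::real. exp (- \<i> * of_real x *
          of_real (Arg (1 - inverse (of_real b) * exp (\<i> * of_real \<theta>)))))"

text \<open>
  Asymptotic expansion of \<open>f x\<close> as \<open>x \<rightarrow> +\<infinity>\<close> with respect to the scale
  \<open>x powr (- k - 1/2)\<close>, the coefficient at order \<open>k\<close> being a trigonometric term of
  frequency \<open>\<beta>\<close> and phase \<open>- pi/4\<close>. The real numbers \<open>p k\<close> and \<open>q k\<close> do not depend
  on \<open>x\<close>, so (for \<open>\<beta> \<noteq> 0\<close>) they are uniquely determined by \<open>f\<close>.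
\<close>
definition has_trig_asymp_expansion ::
    "(real \<Rightarrow> complex) \<Rightarrow> real \<Rightarrow> (nat \<Rightarrow> real) \<Rightarrow> (nat \<Rightarrow> real) \<Rightarrow> bool" where
  "has_trig_asymp_expansion f \<beta> p q \<longleftrightarrow>
     (\<forall>N. (\<lambda>x. f x - of_real
              (\<Sum>k<N. (p k * cos (x * \<beta> - pi/4) + q k * sin (x * \<beta> - pi/4))
                        * x powr (- real k - 1/2)))
            \<in> O[at_top](\<lambda>x. of_real (x powr (- real N - 1/2))))"

end

theory Submission
  imports Defs "HOL-Probability.Distributions" "HOL-Complex_Analysis.Complex_Analysis"
    "HOL-Real_Asymp.Real_Asymp"
begin

text \<open>
  Substituting \<open>\<theta> = t - A(t)\<close> with \<open>A(t) = arcsin (sin t / b)\<close> turns the argument into \<open>- A(t)\<close>, and the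
  extra term \<open>A'(t) exp (i x A(t))\<close> integrates to \<open>0\<close> over a period. By symmetry, the integral is
  \<open>2/pi\<close> times the real part of the integral of \<open>exp (i x A(t))\<close> over \<open>[0, pi/2]\<close>. The phase \<open>A\<close> extends
  holomorphically to a strip, so the path can be moved: up the imaginary axis (where only the
  imaginary part is affected), then along a segment with \<open>Im A > 0\<close> (exponentially small), and
  finally down to the stationary point \<open>pi/2\<close> along the curve \<open>A = \<beta> + i v\<^sup>2\<close> of steepest descent.
  The last piece is a Gaussian integral, expanded by Watson's lemma; its density satisfies an
  algebraic equation that yields the first three coefficients.
\<close>

subsection \<open>Reduction to an arcsine phase\<close>

text \<open>The substitution keeps the limits of integration because \<open>t - A(t)\<close> fixes
  both ends of the period; its derivative \<open>1 - A'\<close> is the source of the extra term. No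
  contour integrals occur: the strip is convex, so the integrand has a single primitive
  \<open>P\<close> there, and each leg of the path is a difference of values of \<open>P\<close>.
  The obstacle is the endpoint \<open>0\<close>, which is not stationary and by itself would
  contribute integer powers of \<open>1/x\<close>. As \<open>A\<close> is odd and real on the real
  line, it maps the imaginary axis to itself, and the leg along that axis removes this contribution
  exactly. The curve of steepest descent is constructed only near \<open>pi/2\<close>, hence the
  connecting segment. Its parametrization is odd around \<open>pi/2\<close>, so the density depends
  on \<open>v\<^sup>2\<close> alone; only even Gaussian moments arise, which gives the exponents
  \<open>- k - 1/2\<close>. Relative to the leading Taylor coefficient of the density, the next one
  is imaginary and the one after it real; this is why cosine and sine alternate in the three
  terms.\<close>

lemma abs_sin_div_less_one:
  fixes b t :: real
  assumes "b > 1"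
  shows "\<bar>sin t / b\<bar> < 1"
  using assms abs_sin_le_one [of t] by (simp del: abs_sin_le_one)

lemma abs_arcsin_sin_div_le:
  fixes b t :: real
  assumes "b > 1"
  shows "\<bar>arcsin (sin t / b)\<bar> \<le> pi / 2"
proof -
  have "- 1 \<le> sin t / b" "sin t / b \<le> 1"
    using abs_sin_div_less_one [OF assms, of t] by linarith+
  from arcsin_bounded [OF this] show ?thesis by linarith
qed

text \<open>The difference of the two sides is the modulus of
  \<open>1 - exp (i \<theta>) / b\<close> at \<open>\<theta> = t - A\<close>, so positivity is what
  makes the polar form legitimate. It holds because the squares of \<open>cos t / b\<close> and
  \<open>sin t / b\<close> add up to \<open>1 / b^2 < 1\<close>.\<close>

lemma cos_div_less_cos_arcsin:
  fixes b t :: real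
  assumes "b > 1"
  shows "cos t / b < cos (arcsin (sin t / b))"
proof -
  have s: "\<bar>sin t / b\<bar> < 1" using assms by (rule abs_sin_div_less_one)
  have "(cos t / b)\<^sup>2 + (sin t / b)\<^sup>2 = 1 / b\<^sup>2"
    by (simp add: power_divide add_divide_distrib [symmetric])
  also have "\<dots> < 1" using assms by simp
  finally have "(cos t / b)\<^sup>2 < 1 - (sin t / b)\<^sup>2" by simp
  then have "cos t / b < sqrt (1 - (sin t / b)\<^sup>2)" by (rule real_less_rsqrt)
  also have "\<dots> = cos (arcsin (sin t / b))"
    using s by (intro cos_arcsin [symmetric]) linarith+
  finally show ?thesis .
qed

text \<open>The sine rule in the triangle with vertices \<open>0\<close>, \<open>1\<close> and \<open>1 - exp (i \<theta>) / b\<close> turns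
  the argument into an arcsine.\<close>
lemma Arg_one_minus_exp:
  fixes b t :: real
  assumes "b > 1"
  shows "Arg (1 - inverse (of_real b) * exp (\<i> * of_real (t - arcsin (sin t / b)))) = - arcsin (sin t / b)"
proof -
  define A where "A = arcsin (sin t / b)"
  have s: "\<bar>sin t / b\<bar> < 1" using assms by (rule abs_sin_div_less_one)
  have sinA: "sin A = sin t / b" unfolding A_def using s by (intro sin_arcsin) linarith+
  have A: "\<bar>A\<bar> \<le> pi / 2"
    using abs_arcsin_sin_div_le [OF assms] by (simp add: A_def)
  have "of_real (cos A - cos t / b) * exp (\<i> * of_real (- A)) = 1 - inverse (of_real b) * exp (\<i> * of_real (t - A))"
  proof -
    \<comment> \<open>The right-hand side is real because \<open>sin A = sin t / b\<close> cancels
      its imaginary part.\<close>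
    have "of_real (cos A - cos t / b) = exp (\<i> * of_real A) - inverse (of_real b) * exp (\<i> * of_real t)"
    proof -
      have inv: "inverse (of_real b) = complex_of_real (inverse b)" by simp
      then show ?thesis
        unfolding cis_conv_exp [symmetric] inv
        by (intro complex_eqI) (simp_all add: sinA divide_inverse mult.commute del: of_real_inverse)
    qed
    moreover have "exp (\<i> * of_real A) * exp (\<i> * of_real (- A)) = 1"
      by (simp flip: exp_add)
    moreover have "exp (\<i> * of_real (t - A)) = exp (\<i> * of_real t) * exp (\<i> * of_real (- A))"
      by (simp add: right_diff_distrib flip: exp_add)
    ultimately show ?thesis
      by (simp only: left_diff_distrib mult.assoc)
  qed
  then show ?thesis
    unfolding A_def [symmetric]
    by (rule Arg_unique) (use cos_div_less_cos_arcsin [OF assms, of t] A pi_gt_zero in \<open>auto simp: A_def simp del: pi_gt_zero\<close>)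
qed

text \<open>For \<open>b > 1\<close> the circle around \<open>1\<close> of radius \<open>1/b\<close>
  lies in the right half-plane, away from the branch cut of \<open>Arg\<close>.\<close>

lemma continuous_on_Arg_one_minus_exp:
  fixes b :: real
  assumes "b > 1"
  shows "continuous_on S (\<lambda>\<theta>. Arg (1 - inverse (of_real b) * exp (\<i> * of_real \<theta>)))"
proof (rule continuous_on_compose2 [of "- \<real>\<^sub>\<le>\<^sub>0" Arg])
  show "continuous_on (- \<real>\<^sub>\<le>\<^sub>0) Arg"
    by (auto intro!: continuous_at_imp_continuous_on continuous_at_Arg)
  show "(\<lambda>\<theta>. 1 - inverse (of_real b) * exp (\<i> * of_real \<theta>)) ` S \<subseteq> - \<real>\<^sub>\<le>\<^sub>0"
  proof clarify
    fix \<theta> :: real assume "1 - inverse (of_real b) * exp (\<i> * of_real \<theta>) \<in> \<real>\<^sub>\<le>\<^sub>0"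
    then have "Re (1 - inverse (of_real b) * exp (\<i> * of_real \<theta>)) \<le> 0"
      by (auto simp: complex_nonpos_Reals_iff)
    then have "1 \<le> cos \<theta> / b" by (simp add: Re_exp divide_inverse mult.commute del: of_real_inverse flip: of_real_inverse)
    moreover have "cos \<theta> / b < 1" using assms cos_le_one [of \<theta>] by (simp add: field_simps del: cos_le_one)
    ultimately show False by simp
  qed
qed (intro continuous_intros)

lemma has_real_derivative_arcsin_sin_div:
  fixes b t :: real
  assumes "b > 1"
  shows "((\<lambda>t. arcsin (sin t / b)) has_real_derivative (cos t / b) / sqrt (1 - (sin t / b)\<^sup>2)) (at t within S)"
proof -
  have s: "\<bar>sin t / b\<bar> < 1" using assms by (rule abs_sin_div_less_one)
  show ?thesis
    by (rule DERIV_subset [OF _ subset_UNIV], rule derivative_eq_intros refl | use s assms in \<open>force simp: divide_inverse mult_ac\<close>)+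
qed

lemma arg_integral_eq_arcsin_integral:
  fixes b x :: real
  assumes b: "b > 1" and x: "x \<noteq> 0"
  shows "arg_integral b x = 1 / (2 * of_real pi) *
           integral {0..2*pi} (\<lambda>t. exp (\<i> * of_real (x * arcsin (sin t / b))))"
proof -
  let ?A = "\<lambda>t. arcsin (sin t / b)"
  let ?A' = "\<lambda>t. (cos t / b) / sqrt (1 - (sin t / b)\<^sup>2)"
  let ?f = "\<lambda>\<theta>::real. exp (- \<i> * of_real x * of_real (Arg (1 - inverse (of_real b) * exp (\<i> * of_real \<theta>))))"
  let ?E = "\<lambda>t. exp (\<i> * complex_of_real (x * ?A t))"
  have A_bound: "\<bar>?A t\<bar> \<le> pi / 2" for t
    by (rule abs_arcsin_sin_div_le [OF b])
  have "((\<lambda>t. (1 - ?A' t) *\<^sub>R ?f (t - ?A t)) has_integral integral {0 - ?A 0..2 * pi - ?A (2 * pi)} ?f) {0..2*pi}"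
  \<comment> \<open>Since \<open>A\<close> is bounded by \<open>pi/2\<close>, the map
    \<open>t - A(t)\<close> sends the period into \<open>{- pi..3 * pi}\<close>, with room to
    spare.\<close>
  proof (rule has_integral_substitution [where c = "- pi" and d = "3 * pi"])
    show "(\<lambda>t. t - ?A t) ` {0..2 * pi} \<subseteq> {- pi..3 * pi}"
    proof clarify
      fix t assume "t \<in> {0..2 * pi}"
      then show "t - ?A t \<in> {- pi..3 * pi}" using A_bound [of t] pi_gt_zero by (auto simp del: pi_gt_zero)
    qed
    show "continuous_on {- pi..3 * pi} ?f"
      by (intro continuous_intros continuous_on_Arg_one_minus_exp b)
    show "((\<lambda>t. t - ?A t) has_real_derivative 1 - ?A' t) (at t within {0..2 * pi})" for t
      by (intro derivative_intros has_real_derivative_arcsin_sin_div b)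
  qed auto
  then have 1: "((\<lambda>t. (1 - ?A' t) *\<^sub>R ?E t) has_integral integral {0..2 * pi} ?f) {0..2*pi}"
    unfolding Arg_one_minus_exp [OF b] by (simp add: mult_ac)
  \<comment> \<open>The primitive \<open>?E / (i x)\<close> takes equal values at both ends because
    \<open>sin\<close> vanishes there; dividing by \<open>x\<close> is where
    \<open>x \<noteq> 0\<close> enters.\<close>
  have "((\<lambda>t. ?A' t *\<^sub>R ?E t) has_integral (?E (2 * pi) / (\<i> * x) - ?E 0 / (\<i> * x))) {0..2*pi}"
  proof (rule fundamental_theorem_of_calculus)
    fix t
    have "((\<lambda>t. complex_of_real (?A t)) has_vector_derivative of_real (?A' t)) (at t)"
      by (intro has_vector_derivative_of_real) (rule has_real_derivative_arcsin_sin_div [OF b])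
    moreover have "((\<lambda>z. exp (\<i> * x * z) / (\<i> * x)) has_field_derivative exp (\<i> * x * ?A t)) (at (of_real (?A t)))"
      by (auto intro!: derivative_eq_intros simp: x)
    ultimately have "((\<lambda>z. exp (\<i> * x * z) / (\<i> * x)) \<circ> (\<lambda>t. complex_of_real (?A t)) has_vector_derivative
        of_real (?A' t) * exp (\<i> * x * ?A t)) (at t)"
      by (rule field_vector_diff_chain_at)
    then have "((\<lambda>t. ?E t / (\<i> * x)) has_vector_derivative ?A' t *\<^sub>R ?E t) (at t)"
      by (simp add: o_def scaleR_conv_of_real mult.assoc)
    then show "((\<lambda>t. ?E t / (\<i> * x)) has_vector_derivative ?A' t *\<^sub>R ?E t) (at t within {0..2 * pi})"
      by (rule has_vector_derivative_at_within)
  qed simp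
  then have "((\<lambda>t. ?A' t *\<^sub>R ?E t) has_integral 0) {0..2*pi}" by simp
  from has_integral_add [OF 1 this]
  have "(?E has_integral integral {0..2 * pi} ?f) {0..2*pi}"
    by (simp add: scaleR_left_diff_distrib)
  then show ?thesis
    unfolding arg_integral_def by (simp add: integral_unique)
qed

section \<open>Symmetries of the sine over a period\<close>

lemma integral_comp_sin_period:
  fixes h :: "real \<Rightarrow> complex"
  assumes "continuous_on {-1..1} h"
  shows "integral {0..2*pi} (\<lambda>t. h (sin t)) = 2 * integral {0..pi/2} (\<lambda>t. h (sin t) + h (- sin t))"
proof -
  have cont: "continuous_on S (\<lambda>t. h (sin t))" "continuous_on S (\<lambda>t. h (- sin t))" for S
    by (rule continuous_on_compose2 [OF assms], auto intro!: continuous_intros)+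
  have int: "(\<lambda>t. h (sin t)) integrable_on {u..v}" "(\<lambda>t. h (- sin t)) integrable_on {u..v}" for u v
    by (auto intro!: integrable_continuous_real cont)
  \<comment> \<open>Shifting by \<open>pi\<close> and then reflecting amounts to
    \<open>t \<mapsto> pi - t\<close>, under which \<open>sin\<close> is invariant.\<close>
  have half: "integral {0..pi} (\<lambda>t. g (sin t)) = 2 * integral {0..pi/2} (\<lambda>t. g (sin t))"
    if g: "\<And>u v. (\<lambda>t. g (sin t)) integrable_on {u..v}" for g :: "real \<Rightarrow> complex"
  proof -
    have "integral {pi/2..pi} (\<lambda>t. g (sin t)) = integral {pi/2 - pi..pi - pi} (\<lambda>t. g (sin (t + pi)))"
      by (rule integral_shift_real_ivl [symmetric])
    also have "\<dots> = integral {-(pi/2)..-0} (\<lambda>t. g (sin (- t)))"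
      by simp
    also have "\<dots> = integral {0..pi/2} (\<lambda>t. g (sin t))"
      using Henstock_Kurzweil_Integration.integral_reflect_real [of "pi/2" 0 "\<lambda>t. g (sin t)"] by simp
    finally show ?thesis
      using Henstock_Kurzweil_Integration.integral_combine [of 0 "pi/2" pi "\<lambda>t. g (sin t)"] g by simp
  qed
  have "integral {pi..2*pi} (\<lambda>t. h (sin t)) = integral {pi - pi..2*pi - pi} (\<lambda>t. h (sin (t + pi)))"
    by (rule integral_shift_real_ivl [symmetric])
  also have "\<dots> = integral {0..pi} (\<lambda>t. h (- sin t))" by simp
  finally have "integral {pi..2*pi} (\<lambda>t. h (sin t)) = 2 * integral {0..pi/2} (\<lambda>t. h (- sin t))"
    using half [of "\<lambda>s. h (- s)", OF int(2)] by (simp only:)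
  moreover have "integral {0..pi} (\<lambda>t. h (sin t)) = 2 * integral {0..pi/2} (\<lambda>t. h (sin t))"
    by (rule half) (rule int)
  moreover have "integral {0..pi} (\<lambda>t. h (sin t)) + integral {pi..2*pi} (\<lambda>t. h (sin t)) = integral {0..2*pi} (\<lambda>t. h (sin t))"
    by (rule Henstock_Kurzweil_Integration.integral_combine) (use int in auto)
  moreover have "integral {0..pi/2} (\<lambda>t. h (sin t) + h (- sin t)) = integral {0..pi/2} (\<lambda>t. h (sin t)) + integral {0..pi/2} (\<lambda>t. h (- sin t))"
    by (rule Henstock_Kurzweil_Integration.integral_add) (use int in auto)
  ultimately show ?thesis by (simp only: distrib_left)
qed

text \<open>Since \<open>arcsin\<close> is odd, quarters on which \<open>sin\<close> has opposite
  signs contribute conjugate values. The constant is \<open>1 / (2 pi)\<close> times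
  \<open>2\<close> for the equal quarters times \<open>2\<close> from
  \<open>z + cnj z = 2 Re z\<close>.\<close>

lemma arg_integral_eq_quarter:
  fixes b x :: real
  assumes b: "b > 1" and x: "x \<noteq> 0"
  shows "arg_integral b x = of_real (2 / pi *
           Re (integral {0..pi/2} (\<lambda>t. exp (\<i> * of_real (x * arcsin (sin t / b))))))"
proof -
  let ?h = "\<lambda>s. exp (\<i> * complex_of_real (x * arcsin (s / b)))"
  have cont: "continuous_on {-1..1} ?h"
    using b by (intro continuous_intros) (auto simp: field_simps)
  from cont have "integral {0..2*pi} (\<lambda>t. ?h (sin t)) = 2 * integral {0..pi/2} (\<lambda>t. ?h (sin t) + ?h (- sin t))"
    by (rule integral_comp_sin_period)
  also have "(\<lambda>t. ?h (sin t) + ?h (- sin t)) = (\<lambda>t. of_real (2 * Re (?h (sin t))))"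
  proof
    fix t
    have "?h (- sin t) = cnj (?h (sin t))"
    proof -
      have "arcsin (- (sin t / b)) = - arcsin (sin t / b)"
        using abs_sin_div_less_one [OF b, of t] by (intro arcsin_minus) linarith+
      then show ?thesis by (simp add: exp_cnj)
    qed
    then show "?h (sin t) + ?h (- sin t) = of_real (2 * Re (?h (sin t)))"
      by (simp add: complex_add_cnj)
  qed
  also have "integral {0..pi/2} (\<lambda>t. complex_of_real (2 * Re (?h (sin t)))) = of_real (2 * Re (integral {0..pi/2} (\<lambda>t. ?h (sin t))))"
  proof (rule integral_unique, rule has_integral_of_real, rule has_integral_mult_right, rule has_integral_Re, rule integrable_integral, rule integrable_continuous_real)
    show "continuous_on {0..pi/2} (\<lambda>t. ?h (sin t))"
      by (rule continuous_on_compose2 [OF cont]) (auto intro!: continuous_intros)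
  qed
  finally show ?thesis
    using arg_integral_eq_arcsin_integral [OF b x] by simp
qed

subsection \<open>Watson's lemma for Gaussian integrals\<close>

text \<open>This is \<open>Gamma (k + 1/2) / 2\<close>, the integral of
  \<open>exp (- v^2) * v^(2k)\<close> over the positive half-line.\<close>

definition half_gauss_moment :: "nat \<Rightarrow> real" where
  "half_gauss_moment k = (sqrt pi / 2) * (fact (2 * k) / (2 ^ (2 * k) * fact k))"

lemma has_integral_gauss_moment:
  assumes "x > 0"
  shows "((\<lambda>v. exp (- (x * v\<^sup>2)) * v ^ (2 * k)) has_integral
           half_gauss_moment k * x powr (- real k - 1/2)) {0..}"
proof -
  define y where "y = sqrt x"
  have y: "y > 0" "y\<^sup>2 = x" using assms by (auto simp: y_def)
  have "has_bochner_integral lborel (\<lambda>v. indicator {0..} (0 + y * v) *\<^sub>R (exp (- (0 + y * v)\<^sup>2) * (0 + y * v) ^ (2 * k)))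
          (half_gauss_moment k /\<^sub>R \<bar>y\<bar>)"
    unfolding half_gauss_moment_def
    by (rule iffD1 [OF lborel_has_bochner_integral_real_affine_iff gaussian_moment_even_pos]) (use y in simp)
  then have "((\<lambda>v. indicator {0..} (y * v) *\<^sub>R (exp (- (y * v)\<^sup>2) * (y * v) ^ (2 * k))) has_integral
          (half_gauss_moment k / y)) UNIV"
    using has_integral_integral_lborel [of "\<lambda>v. indicator {0..} (y * v) *\<^sub>R (exp (- (y * v)\<^sup>2) * (y * v) ^ (2 * k))"] y
    by (simp only: has_bochner_integral_iff add_0 abs_of_pos real_scaleR_def divide_inverse mult.commute)
  also have "(\<lambda>v. indicator {0..} (y * v) *\<^sub>R (exp (- (y * v)\<^sup>2) * (y * v) ^ (2 * k)))
           = (\<lambda>v. if v \<in> {0..} then y ^ (2 * k) * (exp (- (x * v\<^sup>2)) * v ^ (2 * k)) else 0)"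
    using y by (auto simp: fun_eq_iff indicator_def zero_le_mult_iff power_mult_distrib)
  finally have "((\<lambda>v. y ^ (2 * k) * (exp (- (x * v\<^sup>2)) * v ^ (2 * k))) has_integral (half_gauss_moment k / y)) {0..}"
    by (simp only: has_integral_restrict_UNIV)
  from has_integral_mult_right [OF this, of "inverse (y ^ (2 * k))"]
  have "((\<lambda>v. exp (- (x * v\<^sup>2)) * v ^ (2 * k)) has_integral (half_gauss_moment k / y / y ^ (2 * k))) {0..}"
    using y by (simp add: field_simps)
  also have "half_gauss_moment k / y / y ^ (2 * k) = half_gauss_moment k * x powr (- real k - 1/2)"
  proof -
    have 1: "x powr real k = y ^ (2 * k)" "x powr (1/2) = y"
      using assms y by (auto simp: powr_realpow power_mult powr_half_sqrt y_def)
    show ?thesis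
      unfolding powr_diff powr_minus 1 by (simp only: divide_inverse mult.assoc mult.commute mult.left_commute)
  qed
  finally show ?thesis .
qed

lemma truncated_gauss_moment_le:
  assumes "x > 0" "\<epsilon> > 0"
  shows "integral {0..\<epsilon>} (\<lambda>v. exp (- (x * v\<^sup>2)) * v ^ (2 * k)) \<le> half_gauss_moment k * x powr (- real k - 1/2)"
proof -
  have "integral {0..\<epsilon>} (\<lambda>v. exp (- (x * v\<^sup>2)) * v ^ (2 * k)) \<le> integral {0..} (\<lambda>v. exp (- (x * v\<^sup>2)) * v ^ (2 * k))"
    by (rule integral_subset_le)
       (use has_integral_gauss_moment [OF assms(1)] in \<open>auto intro!: integrable_continuous_real continuous_intros\<close>)
  then show ?thesis using integral_unique [OF has_integral_gauss_moment [OF assms(1), of k]] by simp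
qed

text \<open>Beyond \<open>\<epsilon>\<close> one has
  \<open>x v^2 \<ge> (x - 1) \<epsilon>^2 + v^2\<close>: one unit of \<open>x\<close> is kept back
  so that the tail stays integrable, and the rest becomes an exponentially small factor.\<close>

lemma truncated_gauss_moment_ge:
  assumes "x \<ge> 1" "\<epsilon> > 0"
  shows "half_gauss_moment k * x powr (- real k - 1/2) - integral {0..\<epsilon>} (\<lambda>v. exp (- (x * v\<^sup>2)) * v ^ (2 * k))
           \<le> exp (- ((x - 1) * \<epsilon>\<^sup>2)) * half_gauss_moment k"
proof -
  let ?f = "\<lambda>x v::real. exp (- (x * v\<^sup>2)) * v ^ (2 * k)"
  have hf: "(?f y has_integral half_gauss_moment k * y powr (- real k - 1/2)) {0..}" if "y > 0" for y
    using that by (rule has_integral_gauss_moment)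
  have hi: "(?f y has_integral integral {0..\<epsilon>} (?f y)) {0..\<epsilon>}" for y
    by (intro integrable_integral integrable_continuous_real continuous_intros)
  let ?g = "\<lambda>v. if v \<in> {0..\<epsilon>} then ?f x v else 0"
  have h3: "(?g has_integral integral {0..\<epsilon>} (?f x)) {0..}"
    by (subst has_integral_restrict) (use hi assms in auto)
  have "((\<lambda>v. ?f x v - ?g v) has_integral
          (half_gauss_moment k * x powr (- real k - 1/2) - integral {0..\<epsilon>} (?f x))) {0..}"
    by (rule has_integral_diff [OF hf h3]) (use assms in auto)
  moreover have "((\<lambda>v. exp (- ((x - 1) * \<epsilon>\<^sup>2)) * ?f 1 v) has_integral
         exp (- ((x - 1) * \<epsilon>\<^sup>2)) * half_gauss_moment k) {0..}"
    using has_integral_mult_right [OF hf [of 1]] by simp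
  moreover have "?f x v - ?g v \<le> exp (- ((x - 1) * \<epsilon>\<^sup>2)) * ?f 1 v" if "v \<in> {0..}" for v
  proof (cases "v \<le> \<epsilon>")
    case True
    then show ?thesis using that by simp
  next
    case False
    then have "(x - 1) * \<epsilon>\<^sup>2 \<le> (x - 1) * v\<^sup>2"
      using assms by (intro mult_left_mono power_mono) auto
    then have "exp (- (x * v\<^sup>2)) \<le> exp (- ((x - 1) * \<epsilon>\<^sup>2)) * exp (- v\<^sup>2)"
      by (simp add: exp_add [symmetric] algebra_simps)
    then have "exp (- (x * v\<^sup>2)) * v ^ (2 * k) \<le> exp (- ((x - 1) * \<epsilon>\<^sup>2)) * exp (- v\<^sup>2) * v ^ (2 * k)"
      by (intro mult_right_mono) auto
    then show ?thesis using False by (simp add: mult_ac)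
  qed
  ultimately show ?thesis
    by (rule has_integral_le)
qed

text \<open>The error has two sources. The remainder of \<open>g\<close> is integrated against the
  Gaussian and costs at most a multiple of the \<open>N\<close>-th moment, which has exactly the
  claimed order; completing the truncated moments to the half-line costs only exponentially small
  terms.\<close>

lemma watson_gauss:
  fixes g :: "real \<Rightarrow> complex" and d :: "nat \<Rightarrow> complex"
  assumes eps: "\<epsilon> > 0" and cont: "continuous_on {0..\<epsilon>} g"
    and rem: "\<And>v. v \<in> {0..\<epsilon>} \<Longrightarrow> norm (g v - (\<Sum>k<N. d k * of_real (v ^ (2 * k)))) \<le> C * v ^ (2 * N)"
  shows "(\<lambda>x. integral {0..\<epsilon>} (\<lambda>v. of_real (exp (- (x * v\<^sup>2))) * g v)
              - (\<Sum>k<N. d k * of_real (half_gauss_moment k * x powr (- real k - 1/2))))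
           \<in> O[at_top](\<lambda>x. of_real (x powr (- real N - 1/2)))"
proof -
  define G where "G k x = integral {0..\<epsilon>} (\<lambda>v. exp (- (x * v\<^sup>2)) * v ^ (2 * k))" for k and x :: real
  have hG: "((\<lambda>v. exp (- (x * v\<^sup>2)) * v ^ (2 * k)) has_integral G k x) {0..\<epsilon>}" for k x
    unfolding G_def by (intro integrable_integral integrable_continuous_real continuous_intros)
  have C: "C \<ge> 0"
  proof -
    have "0 \<le> C * \<epsilon> ^ (2 * N)" using rem [of \<epsilon>] eps by (auto intro: order_trans [OF norm_ge_zero])
    moreover have "\<epsilon> ^ (2 * N) > 0" using eps by simp
    ultimately show ?thesis by (simp only: zero_le_mult_iff) linarith
  qed
  let ?h = "\<lambda>x v. complex_of_real (exp (- (x * v\<^sup>2))) * g v"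
  have telescope: "p - q + (q - r) = p - r" for p q r :: complex
    by simp
  have main: "norm (integral {0..\<epsilon>} (?h x) - (\<Sum>k<N. d k * of_real (G k x)))
                \<le> C * half_gauss_moment N * x powr (- real N - 1/2)" if "x > 0" for x
  proof -
    have hh: "(?h x has_integral integral {0..\<epsilon>} (?h x)) {0..\<epsilon>}"
      by (intro integrable_integral integrable_continuous_real continuous_intros cont)
    have "((\<lambda>v. complex_of_real (exp (- (x * v\<^sup>2)) * v ^ (2 * k))) has_integral of_real (G k x)) {0..\<epsilon>}" for k
      by (rule has_integral_of_real [OF hG])
    then have "((\<lambda>v. \<Sum>k<N. d k * complex_of_real (exp (- (x * v\<^sup>2)) * v ^ (2 * k))) has_integral
                 (\<Sum>k<N. d k * of_real (G k x))) {0..\<epsilon>}"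
      by (intro has_integral_sum has_integral_mult_right) auto
    from has_integral_diff [OF hh this]
    have 1: "((\<lambda>v. of_real (exp (- (x * v\<^sup>2))) * (g v - (\<Sum>k<N. d k * of_real (v ^ (2 * k))))) has_integral
            (integral {0..\<epsilon>} (?h x) - (\<Sum>k<N. d k * of_real (G k x)))) {0..\<epsilon>}"
      by (simp add: algebra_simps sum_distrib_left)
    have 2: "((\<lambda>v. C * (exp (- (x * v\<^sup>2)) * v ^ (2 * N))) has_integral C * G N x) {0..\<epsilon>}"
      by (intro has_integral_mult_right hG)
    have "norm (integral {0..\<epsilon>} (\<lambda>v. of_real (exp (- (x * v\<^sup>2))) * (g v - (\<Sum>k<N. d k * of_real (v ^ (2 * k))))))
            \<le> integral {0..\<epsilon>} (\<lambda>v. C * (exp (- (x * v\<^sup>2)) * v ^ (2 * N)))"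
    proof (rule integral_norm_bound_integral)
      fix v assume v: "v \<in> {0..\<epsilon>}"
      have "norm (of_real (exp (- (x * v\<^sup>2))) * (g v - (\<Sum>k<N. d k * of_real (v ^ (2 * k)))))
              \<le> exp (- (x * v\<^sup>2)) * (C * v ^ (2 * N))"
        unfolding norm_mult using rem [OF v] by (intro mult_mono) auto
      then show "norm (of_real (exp (- (x * v\<^sup>2))) * (g v - (\<Sum>k<N. d k * of_real (v ^ (2 * k)))))
              \<le> C * (exp (- (x * v\<^sup>2)) * v ^ (2 * N))" by (simp add: mult_ac)
    qed (use 1 2 in auto)
    then have "norm (integral {0..\<epsilon>} (?h x) - (\<Sum>k<N. d k * of_real (G k x))) \<le> C * G N x"
      unfolding integral_unique [OF 1] integral_unique [OF 2] .
    also have "\<dots> \<le> C * (half_gauss_moment N * x powr (- real N - 1/2))"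
      using C truncated_gauss_moment_le [OF that eps, of N] by (intro mult_left_mono) (auto simp: G_def)
    finally show ?thesis by (simp add: mult_ac)
  qed
  have "(\<lambda>x. integral {0..\<epsilon>} (?h x) - (\<Sum>k<N. d k * of_real (G k x))) \<in> O[at_top](\<lambda>x. of_real (x powr (- real N - 1/2)))"
    by (rule bigoI [where c = "C * half_gauss_moment N"], rule eventually_mono [OF eventually_gt_at_top [of 0]])
       (use main in auto)
  \<comment> \<open>Completion of the moments: each difference is squeezed between \<open>0\<close>
    and an exponentially small bound.\<close>
  moreover have "(\<lambda>x. \<Sum>k<N. d k * of_real (G k x - half_gauss_moment k * x powr (- real k - 1/2)))
                   \<in> O[at_top](\<lambda>x. of_real (x powr (- real N - 1/2)))"
  proof (intro big_sum_in_bigo)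
    fix k
    have "(\<lambda>x. G k x - half_gauss_moment k * x powr (- real k - 1/2)) \<in> O[at_top](\<lambda>x. exp (- ((x - 1) * \<epsilon>\<^sup>2)))"
    proof (rule bigoI [where c = "half_gauss_moment k"], rule eventually_mono [OF eventually_ge_at_top [of 1]])
      fix x :: real assume x: "x \<ge> 1"
      then have "G k x \<le> half_gauss_moment k * x powr (- real k - 1/2)"
        using truncated_gauss_moment_le [of x \<epsilon> k] eps by (simp add: G_def)
      moreover have "half_gauss_moment k * x powr (- real k - 1/2) - G k x \<le> exp (- ((x - 1) * \<epsilon>\<^sup>2)) * half_gauss_moment k"
        using truncated_gauss_moment_ge [of x \<epsilon> k] eps x by (simp add: G_def)
      ultimately show "norm (G k x - half_gauss_moment k * x powr (- real k - 1/2)) \<le> half_gauss_moment k * norm (exp (- ((x - 1) * \<epsilon>\<^sup>2)))"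
        by (simp add: mult.commute)
    qed
    also have "(\<lambda>x. exp (- ((x - 1) * \<epsilon>\<^sup>2))) \<in> O[at_top](\<lambda>x. x powr (- real N - 1/2))"
      using eps by real_asymp
    finally obtain c where c: "eventually (\<lambda>x. norm (G k x - half_gauss_moment k * x powr (- real k - 1/2))
        \<le> c * norm (x powr (- real N - 1/2))) at_top"
      by (rule landau_o.bigE)
    show "(\<lambda>x. d k * complex_of_real (G k x - half_gauss_moment k * x powr (- real k - 1/2))) \<in> O[at_top](\<lambda>x. of_real (x powr (- real N - 1/2)))"
    proof (rule bigoI [where c = "norm (d k) * c"], rule eventually_mono [OF c])
      fix x assume "norm (G k x - half_gauss_moment k * x powr (- real k - 1/2)) \<le> c * norm (x powr (- real N - 1/2))"
      then have "norm (d k) * norm (G k x - half_gauss_moment k * x powr (- real k - 1/2)) \<le> norm (d k) * (c * norm (x powr (- real N - 1/2)))"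
        by (rule mult_left_mono) simp
      then show "norm (d k * complex_of_real (G k x - half_gauss_moment k * x powr (- real k - 1/2)))
             \<le> norm (d k) * c * norm (complex_of_real (x powr (- real N - 1/2)))"
        by (simp only: norm_mult norm_of_real real_norm_def mult.assoc)
    qed
  qed
  ultimately have "(\<lambda>x. (integral {0..\<epsilon>} (?h x) - (\<Sum>k<N. d k * of_real (G k x))) +
      (\<Sum>k<N. d k * of_real (G k x - half_gauss_moment k * x powr (- real k - 1/2))))
     \<in> O[at_top](\<lambda>x. of_real (x powr (- real N - 1/2)))"
    by (rule sum_in_bigo)
  moreover have "(\<lambda>x. (integral {0..\<epsilon>} (?h x) - (\<Sum>k<N. d k * of_real (G k x))) +
      (\<Sum>k<N. d k * of_real (G k x - half_gauss_moment k * x powr (- real k - 1/2))))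
      = (\<lambda>x. integral {0..\<epsilon>} (?h x) - (\<Sum>k<N. d k * of_real (half_gauss_moment k * x powr (- real k - 1/2))))"
    by (rule ext) (simp only: of_real_diff right_diff_distrib sum_subtractf telescope)
  ultimately show ?thesis by (simp only:)
qed

section \<open>A uniform Taylor remainder on a smaller disc\<close>

lemma fps_remainder_bound:
  fixes f :: "complex \<Rightarrow> complex"
  assumes hol: "f holomorphic_on ball 0 r" and R: "0 < R" "R < r"
  obtains C where "\<And>z. norm z \<le> R \<Longrightarrow>
    norm (f z - (\<Sum>k<N. fps_nth (fps_expansion f 0) k * z ^ k)) \<le> C * norm z ^ N"
proof -
  let ?a = "fps_nth (fps_expansion f 0)"
  have exp: "f has_fps_expansion fps_expansion f 0"
    using hol R by (intro has_fps_expansion_fps_expansion [of "ball 0 r"]) auto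
  have sums: "(\<lambda>n. ?a n * z ^ n) sums f z" if "norm z < r" for z
    using has_fps_expansion_imp_sums_complex [OF exp, of r z] hol that by simp
  have abs: "summable (\<lambda>n. norm (?a n) * R ^ n)"
  proof -
    \<comment> \<open>Convergence at a point strictly between the radii \<open>R\<close> and
      \<open>r\<close> yields absolute convergence at radius \<open>R\<close>.\<close>
    have "norm (of_real ((R + r) / 2) :: complex) < r" using R by (simp del: of_real_add of_real_divide)
    from sums_summable [OF sums [OF this]]
    have "summable (\<lambda>n. norm (?a n * of_real R ^ n))"
      by (rule powser_insidea) (use R in \<open>simp del: of_real_add of_real_divide\<close>)
    then show ?thesis using R by (simp add: norm_mult norm_power)
  qed
  define C where "C = (\<Sum>n. norm (?a (n + N)) * R ^ (n + N)) / R ^ N"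
  show ?thesis
  proof (rule that [of C])
    fix z :: complex assume z: "norm z \<le> R"
    have s1: "summable (\<lambda>n. norm (?a (n + N)) * R ^ (n + N))"
      using abs by (subst summable_iff_shift)
    have "(\<lambda>n. ?a (n + N) * z ^ (n + N)) sums (f z - (\<Sum>k<N. ?a k * z ^ k))"
      using sums [of z] z R by (intro sums_split_initial_segment) auto
    then have eq: "f z - (\<Sum>k<N. ?a k * z ^ k) = (\<Sum>n. ?a (n + N) * z ^ (n + N))"
      by (simp add: sums_iff)
    \<comment> \<open>The factor \<open>norm z ^ N\<close> is pulled out of the tail, and only the
      remaining powers are enlarged to powers of \<open>R\<close>.\<close>
    have le: "norm (?a (n + N) * z ^ (n + N)) \<le> norm (?a (n + N)) * R ^ (n + N) / R ^ N * norm z ^ N" for n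
    proof -
      have "norm z ^ n \<le> R ^ n" using z by (intro power_mono) auto
      then have "norm (?a (n + N)) * norm z ^ N * norm z ^ n \<le> norm (?a (n + N)) * norm z ^ N * R ^ n"
        by (intro mult_left_mono) auto
      then show ?thesis using R by (simp add: norm_mult norm_power power_add mult_ac)
    qed
    have s2: "summable (\<lambda>n. norm (?a (n + N)) * R ^ (n + N) / R ^ N * norm z ^ N)"
      by (intro summable_mult2 summable_divide s1)
    have s3: "summable (\<lambda>n. norm (?a (n + N) * z ^ (n + N)))"
      by (rule summable_comparison_test_ev [OF _ s2]) (use le in auto)
    have "norm (f z - (\<Sum>k<N. ?a k * z ^ k)) \<le> (\<Sum>n. norm (?a (n + N) * z ^ (n + N)))"
      unfolding eq by (rule summable_norm [OF s3])
    also have "\<dots> \<le> (\<Sum>n. norm (?a (n + N)) * R ^ (n + N) / R ^ N * norm z ^ N)"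
      by (rule suminf_le [OF _ s3 s2]) (use le in auto)
    also have "\<dots> = C * norm z ^ N"
      unfolding C_def by (intro sums_unique [symmetric] sums_mult2 sums_divide summable_sums s1)
    finally show "norm (f z - (\<Sum>k<N. ?a k * z ^ k)) \<le> C * norm z ^ N" .
  qed
qed

subsection \<open>Moving the contour\<close>

lemma Re_sin_cosh: "Re (sin z) = sin (Re z) * cosh (Im z)"
  by (simp add: Re_sin cosh_field_def)

lemma Im_sin_sinh: "Im (sin z) = cos (Re z) * sinh (Im z)"
  by (simp add: Im_sin sinh_field_def)

lemma abs_Re_sin_div_less_one:
  assumes "b > 1" "\<bar>Im z\<bar> < arcosh b"
  shows "\<bar>Re (sin z / of_real b)\<bar> < 1"
proof -
  have "cosh (Im z) = cosh \<bar>Im z\<bar>" by simp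
  also have "\<dots> < cosh (arcosh b)"
    using assms cosh_real_strict_mono by (metis abs_ge_zero)
  also have "\<dots> = b" using assms by simp
  finally have "cosh (Im z) < b" .
  moreover have "\<bar>sin (Re z) * cosh (Im z)\<bar> \<le> cosh (Im z)"
    using mult_right_mono [OF abs_sin_le_one [of "Re z"], of "cosh (Im z)"] by (simp add: abs_mult)
  ultimately have "\<bar>sin (Re z) * cosh (Im z)\<bar> < b" by linarith
  then show ?thesis using assms by (simp add: Re_sin_cosh)
qed

definition phase :: "real \<Rightarrow> complex \<Rightarrow> complex" where
  "phase b z = Arcsin (sin z / of_real b)"

text \<open>The half-width is the distance from the real line to the branch points of the phase,
  such as \<open>pi/2 + i arcosh b\<close>, where \<open>sin z = b\<close>.\<close>

definition strip :: "real \<Rightarrow> complex set" where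
  "strip b = {z. \<bar>Im z\<bar> < arcosh b}"

lemma strip_eq: "strip b = {z. Im z < arcosh b} \<inter> {z. - arcosh b < Im z}"
  by (auto simp: strip_def)

lemma open_strip: "open (strip b)"
  unfolding strip_eq by (intro open_Int open_halfspace_Im_lt open_halfspace_Im_gt)

lemma convex_strip: "convex (strip b)"
  unfolding strip_eq
  by (intro convex_Int convex_halfspace_Im_lt convex_halfspace_Im_gt)

lemma of_real_in_strip:
  assumes "b > 1"
  shows "of_real t \<in> strip b"
  using assms by (simp add: strip_def)

lemma holomorphic_phase:
  assumes "b > 1"
  shows "phase b holomorphic_on strip b"
proof -
  have "(\<lambda>z. sin z / of_real b) ` strip b \<subseteq> {z. \<bar>Re z\<bar> < 1}"
    using abs_Re_sin_div_less_one [OF assms] by (auto simp only: strip_def mem_Collect_eq)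
  moreover have "(\<lambda>z. sin z / of_real b) holomorphic_on strip b" "Arcsin holomorphic_on {z. \<bar>Re z\<bar> < 1}"
    using assms by (auto intro!: holomorphic_on_Arcsin holomorphic_intros)
  ultimately have "Arcsin \<circ> (\<lambda>z. sin z / of_real b) holomorphic_on strip b"
    by (metis holomorphic_on_compose_gen)
  then show ?thesis by (simp add: phase_def [abs_def] o_def)
qed

lemma phase_of_real:
  assumes "b > 1"
  shows "phase b (of_real t) = of_real (arcsin (sin t / b))"
proof -
  have "\<bar>sin t / b\<bar> \<le> 1"
    using assms abs_sin_le_one [of t] by (simp del: abs_sin_le_one)
  from of_real_arcsin [OF this] show ?thesis
    by (simp add: phase_def sin_of_real)
qed

text \<open>Take imaginary parts in \<open>sin (phase b z) = sin z / b\<close>. Both real parts lie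
  strictly between \<open>- pi/2\<close> and \<open>pi/2\<close>, so the cosine factors are positive
  and the two imaginary parts have the same sign.\<close>

lemma Im_phase_pos:
  assumes "b > 1" "z \<in> strip b" "\<bar>Re z\<bar> < pi / 2" "Im z > 0"
  shows "Im (phase b z) > 0"
proof -
  have "0 < cos (Re z) * sinh (Im z)"
    using assms by (intro mult_pos_pos cos_gt_zero_pi) auto
  then have "0 < Im (sin z / of_real b)" using assms by (simp add: Im_sin_sinh)
  also have "sin z / of_real b = sin (phase b z)" by (simp add: phase_def)
  finally have 1: "0 < cos (Re (phase b z)) * sinh (Im (phase b z))" by (simp add: Im_sin_sinh)
  have "\<bar>Re (phase b z)\<bar> < pi / 2"
    unfolding phase_def using assms by (intro Arcsin_bounds abs_Re_sin_div_less_one) (auto simp: strip_def)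
  then have "cos (Re (phase b z)) > 0" by (intro cos_gt_zero_pi) auto
  with 1 have "sinh (Im (phase b z)) > 0" by (simp add: zero_less_mult_iff)
  then show ?thesis by simp
qed

lemma phase_imaginary: "phase b (\<i> * of_real q) = \<i> * of_real (arsinh (sinh q / b))"
  unfolding phase_def
proof (rule Arcsin_unique)
  have "sin (\<i> * complex_of_real u) = \<i> * of_real (sinh u)" for u
    by (simp add: complex_eq_iff Re_sin_cosh Im_sin_sinh)
  then show "sin (\<i> * complex_of_real (arsinh (sinh q / b))) = sin (\<i> * complex_of_real q) / complex_of_real b"
    by simp
qed auto

text \<open>On the imaginary axis the integrand is real while \<open>dz\<close> is imaginary, so the real part of the
  integral along it vanishes. Hence the real part of the integral from \<open>0\<close> to \<open>w\<close> comes from a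
  segment on which the integrand is exponentially small.\<close>
lemma contour_remainder:
  assumes b: "b > 1" and w: "w \<in> strip b" "\<bar>Re w\<bar> < pi / 2" "Im w > 0"
  obtains \<delta> where "\<delta> > 0"
    "\<And>x P. x > 0 \<Longrightarrow> (\<And>z. z \<in> strip b \<Longrightarrow> (P has_field_derivative exp (\<i> * of_real x * phase b z)) (at z))
       \<Longrightarrow> \<bar>Re (P w - P 0)\<bar> \<le> norm (w - \<i> * of_real (Im w)) * exp (- (\<delta> * x))"
proof -
  define u where "u = \<i> * complex_of_real (Im w)"
  define S where "S = closed_segment u w"
  have u: "u \<in> strip b" "\<bar>Re u\<bar> < pi / 2" "Im u > 0" using w by (auto simp: u_def strip_def)
  have S_sub: "S \<subseteq> strip b \<inter> {z. Re z < pi / 2} \<inter> {z. - (pi / 2) < Re z} \<inter> {z. 0 < Im z}"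
    unfolding S_def using w u
    by (intro closed_segment_subset convex_Int convex_strip convex_halfspace_Re_lt convex_halfspace_Re_gt convex_halfspace_Im_gt) auto
  have S: "z \<in> strip b" "\<bar>Re z\<bar> < pi / 2" "Im z > 0" if "z \<in> S" for z
    using subsetD [OF S_sub that] unfolding Int_iff mem_Collect_eq abs_less_iff by linarith+
  have "continuous_on S (\<lambda>z. Im (phase b z))"
    using S(1) by (intro continuous_on_Im holomorphic_on_imp_continuous_on holomorphic_on_subset [OF holomorphic_phase [OF b]]) auto
  moreover have "compact S" "S \<noteq> {}" by (auto simp: S_def)
  \<comment> \<open>The rate \<open>\<delta>\<close> will be the minimum of
    \<open>Im (phase b z)\<close> on the compact segment; it is fixed before \<open>x\<close> and
    \<open>P\<close>, so one rate serves all \<open>x\<close>.\<close>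
  ultimately obtain z0 where z0: "z0 \<in> S" "\<And>z. z \<in> S \<Longrightarrow> Im (phase b z0) \<le> Im (phase b z)"
    using continuous_attains_inf [of S "\<lambda>z. Im (phase b z)"] by auto
  show ?thesis
  proof (rule that [of "Im (phase b z0)"])
    show "Im (phase b z0) > 0" using Im_phase_pos [OF b] S z0 by auto
  next
    fix x :: real and P
    assume x: "x > 0" and P: "\<And>z. z \<in> strip b \<Longrightarrow> (P has_field_derivative exp (\<i> * of_real x * phase b z)) (at z)"
    \<comment> \<open>The mean value inequality for \<open>P\<close> takes the place of the estimate
      of a path integral by length times supremum.\<close>
    have "norm (P w - P u) \<le> exp (- (Im (phase b z0) * x)) * norm (w - u)"
    proof (rule field_differentiable_bound [of S P "\<lambda>z. exp (\<i> * of_real x * phase b z)"])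
      show "convex S" "w \<in> S" "u \<in> S" by (auto simp: S_def)
      show "(P has_field_derivative exp (\<i> * of_real x * phase b z)) (at z within S)" if "z \<in> S" for z
        using P [OF S(1) [OF that]] by (rule has_field_derivative_at_within)
      show "norm (exp (\<i> * of_real x * phase b z)) \<le> exp (- (Im (phase b z0) * x))" if "z \<in> S" for z
        using z0(2) [OF that] x by (simp add: mult.commute)
    qed
    moreover have "Re (P u) = Re (P 0)"
    proof -
      have "((\<lambda>q. Re (P (\<i> * of_real q))) has_real_derivative 0) (at q within {0..Im w})" if "q \<in> {0..Im w}" for q
      proof -
        have "((\<lambda>q. \<i> * complex_of_real q) has_vector_derivative \<i> * 1) (at q)"
          by (intro has_vector_derivative_mult_right has_vector_derivative_of_real [of "\<lambda>q. q" 1, simplified]) 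
        moreover have "(P has_field_derivative exp (\<i> * of_real x * phase b (\<i> * of_real q))) (at (\<i> * of_real q))"
          using that w by (intro P) (auto simp: strip_def)
        ultimately have "(P \<circ> (\<lambda>q. \<i> * of_real q) has_vector_derivative \<i> * 1 * exp (\<i> * of_real x * phase b (\<i> * of_real q))) (at q)"
          by (rule field_vector_diff_chain_at)
        from bounded_linear.has_vector_derivative [OF bounded_linear_Re this]
        have "((\<lambda>q. Re (P (\<i> * of_real q))) has_vector_derivative 0) (at q)"
          by (simp add: o_def phase_imaginary Im_exp)
        then show ?thesis
          by (simp add: has_real_derivative_iff_has_vector_derivative has_vector_derivative_at_within)
      qed
      from has_field_derivative_zero_constant [OF convex_real_interval(5) this] obtain k where
        "\<And>q. q \<in> {0..Im w} \<Longrightarrow> Re (P (\<i> * of_real q)) = k" by blast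
      from this [of 0] this [of "Im w"] show ?thesis using w by (simp add: u_def)
    qed
    ultimately show "\<bar>Re (P w - P 0)\<bar> \<le> norm (w - \<i> * of_real (Im w)) * exp (- (Im (phase b z0) * x))"
      using abs_Re_le_cmod [of "P w - P u"] by (simp add: u_def mult.commute)
  qed
qed

subsection \<open>The path of steepest descent\<close>

text \<open>
  With \<open>c = b cos \<beta>\<close> and \<open>s = u\<^sup>2\<close>, the equation \<open>phase b (pi/2 - \<tau>) = \<beta> + i s\<close> reads
  \<open>cos \<tau> = cosh s + i c sinh s\<close>, i.e. \<open>sin\<^sup>2 (\<tau>/2) = M s = s K s\<close>; since \<open>K 0 \<noteq> 0\<close> this has a
  solution \<open>\<tau>\<close> analytic in \<open>u\<close>, and \<open>D s\<close> is its derivative with respect to \<open>u\<close>.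
\<close>
definition sinhc :: "complex \<Rightarrow> complex" where
  "sinhc s = (if s = 0 then 1 / 2 else sinh (s / 2) / s)"

definition saddle_M :: "real \<Rightarrow> complex \<Rightarrow> complex" where
  "saddle_M c s = - sinh (s / 2) * (sinh (s / 2) + \<i> * of_real c * cosh (s / 2))"

definition saddle_K :: "real \<Rightarrow> complex \<Rightarrow> complex" where
  "saddle_K c s = - sinhc s * (sinh (s / 2) + \<i> * of_real c * cosh (s / 2))"

definition saddle_D :: "real \<Rightarrow> complex \<Rightarrow> complex" where
  "saddle_D c s = - (sinh s + \<i> * of_real c * cosh s) / (csqrt (saddle_K c s) * csqrt (1 - saddle_M c s))"

definition saddle_tau :: "real \<Rightarrow> complex \<Rightarrow> complex" where
  "saddle_tau c u = 2 * Arcsin (u * csqrt (saddle_K c (u\<^sup>2)))"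

lemma holomorphic_on_sinh' [holomorphic_intros]:
  "f holomorphic_on A \<Longrightarrow> (\<lambda>z. sinh (f z)) holomorphic_on A"
  by (simp add: sinh_field_def holomorphic_intros)

lemma holomorphic_on_cosh' [holomorphic_intros]:
  "f holomorphic_on A \<Longrightarrow> (\<lambda>z. cosh (f z)) holomorphic_on A"
  by (simp add: cosh_field_def holomorphic_intros)

lemma holomorphic_sinhc: "sinhc holomorphic_on UNIV"
proof -
  have "((\<lambda>s. sinh (s / 2)) has_field_derivative 1 / 2) (at (0 :: complex))"
    by (auto intro!: derivative_eq_intros)
  then have d: "deriv (\<lambda>s. sinh (s / 2)) (0 :: complex) = 1 / 2" by (rule DERIV_imp_deriv)
  have "(\<lambda>s. sinh (s / 2)) holomorphic_on (UNIV :: complex set)"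
    by (intro holomorphic_intros) auto
  then have "(\<lambda>s. if s = 0 then deriv (\<lambda>s. sinh (s / 2)) 0 else (sinh (s / 2) - sinh (0 / 2)) / (s - 0)) holomorphic_on (UNIV :: complex set)"
    by (rule pole_lemma) simp
  then show ?thesis
    unfolding d sinhc_def [abs_def] by (simp only: div_0 sinh_0 diff_zero)
qed

lemma holomorphic_saddle_K: "saddle_K c holomorphic_on A"
  unfolding saddle_K_def [abs_def]
  by (intro holomorphic_intros holomorphic_on_subset [OF holomorphic_sinhc]) auto

lemma holomorphic_saddle_M: "saddle_M c holomorphic_on A"
  unfolding saddle_M_def [abs_def] by (intro holomorphic_intros) auto

lemma saddle_M_eq: "saddle_M c s = s * saddle_K c s"
  by (simp add: saddle_M_def saddle_K_def sinhc_def)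

lemma saddle_K_0: "saddle_K c 0 = - \<i> * of_real c / 2"
  by (simp add: saddle_K_def sinhc_def)

text \<open>With \<open>saddle_M\<close> in the role of \<open>sin^2 (\<tau>/2)\<close>, the
  left-hand side is \<open>cos \<tau>\<close>; the identity is the double-argument formula for
  \<open>sinh\<close> and \<open>cosh\<close>.\<close>

lemma one_minus_saddle_M: "1 - 2 * saddle_M c s = cosh s + \<i> * of_real c * sinh s"
proof -
  define y where "y = s / 2"
  have s: "s = 2 * y" by (simp add: y_def)
  have "1 - 2 * saddle_M c s = 1 + 2 * (sinh y)\<^sup>2 + \<i> * of_real c * (2 * sinh y * cosh y)"
    by (simp add: saddle_M_def y_def [symmetric] algebra_simps power2_eq_square)
  also have "1 + 2 * (sinh y)\<^sup>2 = cosh s"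
    unfolding s by (simp add: cosh_double cosh_square_eq)
  also have "2 * sinh y * cosh y = sinh s"
    unfolding s by (simp add: sinh_double)
  finally show ?thesis .
qed

lemma has_field_derivative_saddle_M:
  "(saddle_M c has_field_derivative - (sinh s + \<i> * of_real c * cosh s) / 2) (at s)"
proof -
  have "((\<lambda>s. (1 - (cosh s + \<i> * of_real c * sinh s)) / 2) has_field_derivative
           - (sinh s + \<i> * of_real c * cosh s) / 2) (at s)"
    by (auto intro!: derivative_eq_intros)
  moreover have "(\<lambda>s. (1 - (cosh s + \<i> * of_real c * sinh s)) / 2) = saddle_M c"
    by (simp add: fun_eq_iff flip: one_minus_saddle_M)
  ultimately show ?thesis by (simp only:)
qed

text \<open>Compares the product rule for \<open>M = s K\<close> with the closed form of
  \<open>M'\<close>. This eliminates the derivative of \<open>K\<close>, whose direct formula is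
  singular at \<open>0\<close>.\<close>

lemma saddle_M_K_deriv:
  assumes "(saddle_K c has_field_derivative k') (at s)"
  shows "saddle_K c s + s * k' = - (sinh s + \<i> * of_real c * cosh s) / 2"
proof -
  have "((\<lambda>s. s * saddle_K c s) has_field_derivative (saddle_K c s + s * k')) (at s)"
    using assms by (auto intro!: derivative_eq_intros)
  then have "(saddle_M c has_field_derivative (saddle_K c s + s * k')) (at s)"
    by (simp add: saddle_M_eq [abs_def])
  then show ?thesis using has_field_derivative_saddle_M by (rule DERIV_unique)
qed

text \<open>The first condition keeps \<open>saddle_K\<close> off the cut of \<open>csqrt\<close>.
  The second does so for \<open>1 - saddle_M\<close>, and also keeps \<open>u * csqrt K\<close>,
  whose square is \<open>M\<close>, inside the unit disc, where \<open>Arcsin\<close> is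
  holomorphic. Both hold near \<open>0\<close> because \<open>K\<close> is \<open>- i c / 2\<close>
  and \<open>M\<close> is \<open>0\<close> there.\<close>

lemma saddle_radius:
  assumes "c > 0"
  obtains r where "r > 0" "\<And>s. s \<in> ball 0 r \<Longrightarrow> Im (saddle_K c s) < 0" "\<And>s. s \<in> ball 0 r \<Longrightarrow> norm (saddle_M c s) < 1"
proof -
  have "isCont (saddle_K c) 0" "isCont (saddle_M c) 0"
    using holomorphic_on_imp_continuous_on [OF holomorphic_saddle_K [of c UNIV]]
      holomorphic_on_imp_continuous_on [OF holomorphic_saddle_M [of c UNIV]]
    by (auto simp: continuous_on_eq_continuous_at)
  then have "((\<lambda>s. Im (saddle_K c s)) \<longlongrightarrow> Im (saddle_K c 0)) (nhds 0)" "((\<lambda>s. norm (saddle_M c s)) \<longlongrightarrow> norm (saddle_M c 0)) (nhds 0)"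
    by (auto intro!: tendsto_intros simp: continuous_at tendsto_at_iff_tendsto_nhds)
  then have "eventually (\<lambda>s. Im (saddle_K c s) < 0) (nhds 0)" "eventually (\<lambda>s. norm (saddle_M c s) < 1) (nhds 0)"
    using assms by (auto intro!: order_tendstoD simp: saddle_K_0 saddle_M_eq)
  then have "eventually (\<lambda>s. Im (saddle_K c s) < 0 \<and> norm (saddle_M c s) < 1) (nhds 0)"
    by (rule eventually_conj)
  then show ?thesis
    using that by (auto simp: eventually_nhds_metric dist_commute)
qed

section \<open>Principal branches and the derivative of the descent curve\<close>

lemma Im_neg_imp_not_nonpos_Real: "Im z < 0 \<Longrightarrow> z \<notin> \<real>\<^sub>\<le>\<^sub>0"
  by (auto simp: complex_nonpos_Reals_iff)

lemma norm_less_one_imp_not_nonpos_Real: "norm (z :: complex) < 1 \<Longrightarrow> 1 - z \<notin> \<real>\<^sub>\<le>\<^sub>0"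
  using complex_Re_le_cmod [of z] by (auto simp: complex_nonpos_Reals_iff)

lemma cos_Arcsin_csqrt:
  assumes "\<bar>Re z\<bar> < 1"
  shows "cos (Arcsin z) = csqrt (1 - z\<^sup>2)"
proof -
  have "\<bar>Re (Arcsin z)\<bar> < pi / 2" using assms by (rule Arcsin_bounds)
  then have "cos (Re (Arcsin z)) > 0" by (intro cos_gt_zero_pi) auto
  then have "Re (cos (Arcsin z)) > 0"
    by (simp add: Re_cos add_pos_pos)
  moreover have "(cos (Arcsin z))\<^sup>2 = 1 - z\<^sup>2" by (simp add: cos_squared_eq)
  ultimately show ?thesis by (intro csqrt_unique [symmetric]) auto
qed

context
  fixes c :: real and u :: complex
  assumes K: "Im (saddle_K c (u\<^sup>2)) < 0" and M: "norm (saddle_M c (u\<^sup>2)) < 1"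
begin

lemma abs_Re_saddle_sigma: "\<bar>Re (u * csqrt (saddle_K c (u\<^sup>2)))\<bar> < 1"
proof -
  have "norm (u * csqrt (saddle_K c (u\<^sup>2))) ^ 2 = norm (saddle_M c (u\<^sup>2))"
    by (simp add: saddle_M_eq norm_mult power_mult_distrib flip: norm_power)
  then have "norm (u * csqrt (saddle_K c (u\<^sup>2))) < 1"
    using M by (intro power2_less_imp_less [of _ 1]) auto
  then show ?thesis using abs_Re_le_cmod le_less_trans by blast
qed

lemma cos_saddle_tau: "cos (saddle_tau c u) = cosh (u\<^sup>2) + \<i> * of_real c * sinh (u\<^sup>2)"
proof -
  have "cos (saddle_tau c u) = 1 - 2 * saddle_M c (u\<^sup>2)"
    by (simp add: saddle_tau_def cos_double_sin saddle_M_eq power_mult_distrib)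
  then show ?thesis by (simp add: one_minus_saddle_M)
qed

text \<open>For \<open>\<sigma> = u sqrt K(u^2)\<close> the derivative is
  \<open>(K + u^2 K') / sqrt K\<close>, and its numerator is \<open>M'(u^2)\<close>. All dependence
  on \<open>u\<close> is thus through \<open>u^2\<close>.\<close>

lemma has_field_derivative_saddle_tau:
  "(saddle_tau c has_field_derivative saddle_D c (u\<^sup>2)) (at u)"
proof -
  let ?\<sigma> = "\<lambda>u. u * csqrt (saddle_K c (u\<^sup>2))"
  obtain k' where k': "(saddle_K c has_field_derivative k') (at (u\<^sup>2))"
    using holomorphic_on_imp_differentiable_at [OF holomorphic_saddle_K open_UNIV] by (auto simp: field_differentiable_def)
  have nz: "csqrt (saddle_K c (u\<^sup>2)) \<noteq> 0" using K by auto
  have "((\<lambda>u. u\<^sup>2) has_field_derivative 2 * u) (at u)" by (auto intro!: derivative_eq_intros)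
  from DERIV_chain2 [OF k' this]
  have "((\<lambda>u. saddle_K c (u\<^sup>2)) has_field_derivative k' * (2 * u)) (at u)" .
  from DERIV_mult [OF DERIV_ident has_field_derivative_csqrt' [OF this Im_neg_imp_not_nonpos_Real [OF K]]]
  have "(?\<sigma> has_field_derivative csqrt (saddle_K c (u\<^sup>2)) + u * (k' * (2 * u) / (2 * csqrt (saddle_K c (u\<^sup>2))))) (at u)"
    by (simp add: mult_ac)
  also have "csqrt (saddle_K c (u\<^sup>2)) + u * (k' * (2 * u) / (2 * csqrt (saddle_K c (u\<^sup>2))))
               = ((csqrt (saddle_K c (u\<^sup>2)))\<^sup>2 + u\<^sup>2 * k') / csqrt (saddle_K c (u\<^sup>2))"
    using nz by (simp add: field_simps power2_eq_square)
  also have "\<dots> = - (sinh (u\<^sup>2) + \<i> * of_real c * cosh (u\<^sup>2)) / 2 / csqrt (saddle_K c (u\<^sup>2))"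
    by (simp only: power2_csqrt saddle_M_K_deriv [OF k'])
  finally have \<sigma>: "(?\<sigma> has_field_derivative - (sinh (u\<^sup>2) + \<i> * of_real c * cosh (u\<^sup>2)) / 2 / csqrt (saddle_K c (u\<^sup>2))) (at u)" .
  have "(Arcsin has_field_derivative inverse (cos (Arcsin (?\<sigma> u)))) (at (?\<sigma> u))"
    using abs_Re_saddle_sigma by (intro has_field_derivative_Arcsin) auto
  also have "cos (Arcsin (?\<sigma> u)) = csqrt (1 - saddle_M c (u\<^sup>2))"
    using abs_Re_saddle_sigma by (simp add: cos_Arcsin_csqrt saddle_M_eq power_mult_distrib)
  finally have "(Arcsin has_field_derivative inverse (csqrt (1 - saddle_M c (u\<^sup>2)))) (at (?\<sigma> u))" .
  from DERIV_cmult [OF DERIV_chain2 [OF this \<sigma>], of 2]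
  have "(saddle_tau c has_field_derivative 2 * (inverse (csqrt (1 - saddle_M c (u\<^sup>2))) *
          (- (sinh (u\<^sup>2) + \<i> * of_real c * cosh (u\<^sup>2)) / 2 / csqrt (saddle_K c (u\<^sup>2))))) (at u)"
    by (simp only: saddle_tau_def [abs_def])
  moreover have "2 * (inverse q * (- y / 2 / p)) = - y / (p * q)" for p q y :: complex
    by (cases "p = 0"; cases "q = 0") (simp_all add: field_simps)
  ultimately show ?thesis by (simp only: saddle_D_def)
qed

end

text \<open>Ensures that \<open>pi/2 - \<tau>\<close> enters the region where positivity of the
  phase is available. The root of \<open>K\<close> has strictly positive real part, since otherwise
  its square would be real; so \<open>sin (\<tau>/2)\<close> has positive real part.\<close>

lemma saddle_tau_bounds:
  assumes K: "Im (saddle_K c ((of_real v)\<^sup>2)) < 0" and M: "norm (saddle_M c ((of_real v)\<^sup>2)) < 1" and v: "v > 0"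
  shows "0 < Re (saddle_tau c (of_real v))" "Re (saddle_tau c (of_real v)) < pi"
proof -
  let ?\<sigma> = "of_real v * csqrt (saddle_K c ((of_real v)\<^sup>2))"
  have b: "\<bar>Re (Arcsin ?\<sigma>)\<bar> < pi / 2"
    by (intro Arcsin_bounds abs_Re_saddle_sigma K M)
  then show "Re (saddle_tau c (of_real v)) < pi" by (simp add: saddle_tau_def)
  have "Re (csqrt (saddle_K c ((of_real v)\<^sup>2))) \<noteq> 0"
  proof
    assume 0: "Re (csqrt (saddle_K c ((of_real v)\<^sup>2))) = 0"
    have "Im ((csqrt (saddle_K c ((of_real v)\<^sup>2)))\<^sup>2) = 0"
      unfolding Im_power2 0 by simp
    then show False using K by simp
  qed
  then have "Re (csqrt (saddle_K c ((of_real v)\<^sup>2))) > 0"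
    using Re_csqrt [of "saddle_K c ((of_real v)\<^sup>2)"] by linarith
  then have "0 < Re (sin (Arcsin ?\<sigma>))" using v by simp
  then have pos: "0 < sin (Re (Arcsin ?\<sigma>))"
    unfolding Re_sin_cosh by (rule zero_less_mult_pos2) (rule cosh_real_pos)
  have "0 < Re (Arcsin ?\<sigma>)"
  proof (rule ccontr)
    assume "\<not> 0 < Re (Arcsin ?\<sigma>)"
    then have "0 \<le> sin (- Re (Arcsin ?\<sigma>))" using b pi_gt_zero by (intro sin_ge_zero) linarith+
    then show False using pos by simp
  qed
  then show "0 < Re (saddle_tau c (of_real v))" by (simp add: saddle_tau_def)
qed

lemma holomorphic_saddle_D:
  assumes "\<And>s. s \<in> A \<Longrightarrow> Im (saddle_K c s) < 0" "\<And>s. s \<in> A \<Longrightarrow> norm (saddle_M c s) < 1"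
  shows "saddle_D c holomorphic_on A"
proof -
  have 1: "saddle_K c s \<notin> \<real>\<^sub>\<le>\<^sub>0" if "s \<in> A" for s
    using assms(1) [OF that] by (rule Im_neg_imp_not_nonpos_Real)
  have 2: "1 - saddle_M c s \<notin> \<real>\<^sub>\<le>\<^sub>0" if "s \<in> A" for s
    using assms(2) [OF that] by (rule norm_less_one_imp_not_nonpos_Real)
  have 3: "csqrt (saddle_K c s) * csqrt (1 - saddle_M c s) \<noteq> 0" if "s \<in> A" for s
    using 1 [OF that] 2 [OF that] by auto
  show ?thesis
    unfolding saddle_D_def [abs_def]
    by (intro holomorphic_intros holomorphic_saddle_K holomorphic_saddle_M 1 2 3)
qed

text \<open>The algebraic equation for the density determines the leading coefficient only up to
  sign; this value selects the branch.\<close>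

lemma saddle_D_0:
  assumes "c > 0"
  shows "saddle_D c 0 = 2 * csqrt (- \<i> * of_real c / 2)"
proof -
  define k where "k = csqrt (- \<i> * of_real c / 2)"
  have nz: "k \<noteq> 0" using assms by (simp add: k_def)
  have "k\<^sup>2 = - \<i> * of_real c / 2" by (simp only: k_def power2_csqrt)
  then have k2: "- (\<i> * of_real c) = 2 * k\<^sup>2" by simp
  have "saddle_M c 0 = 0" by (simp add: saddle_M_def)
  then have "saddle_D c 0 = - (\<i> * of_real c) / k"
    by (simp only: saddle_D_def sinh_0 cosh_0 add_0_left mult_1_right saddle_K_0 k_def [symmetric] diff_zero csqrt_1)
  also have "\<dots> = 2 * k" unfolding k2 using nz by (simp add: power2_eq_square)
  finally show ?thesis by (simp only: k_def)
qed

text \<open>Differentiating \<open>cos \<tau> = cosh s + i c sinh s\<close> with respect to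
  \<open>u\<close>, where \<open>s = u^2\<close>, gives
  \<open>- \<tau>' sin \<tau> = 2 u (sinh s + i c cosh s)\<close>. The equation is its square, free
  of roots; the proof obtains it from \<open>1 - (1 - 2 M)^2 = 4 M (1 - M)\<close>.\<close>

lemma saddle_D_equation:
  assumes "Im (saddle_K c s) < 0" "norm (saddle_M c s) < 1"
  shows "(saddle_D c s)\<^sup>2 * (1 - (cosh s + \<i> * of_real c * sinh s)\<^sup>2) = 4 * s * (sinh s + \<i> * of_real c * cosh s)\<^sup>2"
proof -
  have K: "saddle_K c s \<noteq> 0" using assms(1) by auto
  have M: "1 - saddle_M c s \<noteq> 0" using assms(2) by auto
  have sq: "(- y / (p * q))\<^sup>2 = y\<^sup>2 / (p\<^sup>2 * q\<^sup>2)" for y p q :: complex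
    by (simp add: power_divide power_mult_distrib)
  have "(saddle_D c s)\<^sup>2 = (sinh s + \<i> * of_real c * cosh s)\<^sup>2 / (saddle_K c s * (1 - saddle_M c s))"
    by (simp only: saddle_D_def sq power2_csqrt)
  moreover have "1 - (cosh s + \<i> * of_real c * sinh s)\<^sup>2 = 4 * s * (saddle_K c s * (1 - saddle_M c s))"
    unfolding one_minus_saddle_M [symmetric] by (simp add: saddle_M_eq power2_eq_square algebra_simps)
  moreover have "y / w * (4 * s * w) = 4 * s * y" if "w \<noteq> 0" for y w :: complex
    using that by simp
  ultimately show ?thesis using K M by (simp only: mult_eq_0_iff simp_thms)
qed

subsection \<open>The Taylor coefficients of the density\<close>

lemma has_fps_expansion_cosh: "cosh has_fps_expansion (fps_const (1/2) * (fps_exp 1 + fps_exp (-1)) :: complex fps)"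
proof -
  have "(\<lambda>s. 1 / 2 * (exp s + exp (- s))) has_fps_expansion (fps_const (1/2) * (fps_exp 1 + fps_exp (-1)) :: complex fps)"
    by (intro fps_expansion_intros)
  then show ?thesis by (simp add: cosh_field_def [abs_def])
qed

lemma has_fps_expansion_sinh: "sinh has_fps_expansion (fps_const (1/2) * (fps_exp 1 - fps_exp (-1)) :: complex fps)"
proof -
  have "(\<lambda>s. 1 / 2 * (exp s - exp (- s))) has_fps_expansion (fps_const (1/2) * (fps_exp 1 - fps_exp (-1)) :: complex fps)"
    by (intro fps_expansion_intros)
  then show ?thesis by (simp add: sinh_field_def [abs_def])
qed

definition saddle_coeff :: "real \<Rightarrow> nat \<Rightarrow> complex" where
  "saddle_coeff c k = fps_nth (fps_expansion (saddle_D c) 0) k"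

text \<open>Both sides of the equation for the density vanish at \<open>s = 0\<close>, so
  \<open>d k\<close> enters at order \<open>k + 1\<close>; the three claims compare the coefficients
  of \<open>s\<close>, \<open>s^2\<close> and \<open>s^3\<close>.\<close>

lemma saddle_coeff_equations:
  fixes c :: real
  assumes c: "c > 0"
  defines "d \<equiv> saddle_coeff c"
  shows "d 0 ^ 2 * (- 2 * \<i> * c) = - 4 * c^2"
    and "2 * d 0 * d 1 * (- 2 * \<i> * c) + d 0 ^ 2 * (c^2 - 1) = 8 * \<i> * c"
    and "(2 * d 0 * d 2 + d 1 ^ 2) * (- 2 * \<i> * c) + 2 * d 0 * d 1 * (c^2 - 1) + d 0 ^ 2 * (- 4 * \<i> * c / 3) = 4 * (1 - c^2)"
proof -
  define F where "F = fps_expansion (saddle_D c) 0"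
  define CH where "CH = fps_const (1/2) * (fps_exp 1 + fps_exp (-1 :: complex))"
  define SH where "SH = fps_const (1/2) * (fps_exp 1 - fps_exp (-1 :: complex))"
  define Z where "Z = CH + fps_const (\<i> * of_real c) * SH"
  define Y where "Y = SH + fps_const (\<i> * of_real c) * CH"
  obtain r where r: "r > 0" "\<And>s. s \<in> ball 0 r \<Longrightarrow> Im (saddle_K c s) < 0" "\<And>s. s \<in> ball 0 r \<Longrightarrow> norm (saddle_M c s) < 1"
    using saddle_radius [OF c] by blast
  have F: "saddle_D c has_fps_expansion F"
    unfolding F_def using r by (intro has_fps_expansion_fps_expansion [of "ball 0 r"] holomorphic_saddle_D) auto
  have Z: "(\<lambda>s. cosh s + \<i> * of_real c * sinh s) has_fps_expansion Z"
    unfolding Z_def CH_def SH_def by (intro fps_expansion_intros has_fps_expansion_cosh has_fps_expansion_sinh)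
  have Y: "(\<lambda>s. sinh s + \<i> * of_real c * cosh s) has_fps_expansion Y"
    unfolding Y_def CH_def SH_def by (intro fps_expansion_intros has_fps_expansion_cosh has_fps_expansion_sinh)
  have lhs: "(\<lambda>s. (saddle_D c s)\<^sup>2 * (1 - (cosh s + \<i> * of_real c * sinh s)\<^sup>2)) has_fps_expansion F^2 * (1 - Z^2)"
    by (intro fps_expansion_intros F Z)
  have rhs: "(\<lambda>s. 4 * s * (sinh s + \<i> * of_real c * cosh s)\<^sup>2) has_fps_expansion 4 * fps_X * Y^2"
    by (intro fps_expansion_intros Y)
  have "eventually (\<lambda>s. s \<in> ball 0 r) (nhds (0 :: complex))"
    using r(1) by (intro eventually_nhds_in_open) auto
  then have "eventually (\<lambda>s. (saddle_D c s)\<^sup>2 * (1 - (cosh s + \<i> * of_real c * sinh s)\<^sup>2)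
                = 4 * s * (sinh s + \<i> * of_real c * cosh s)\<^sup>2) (nhds 0)"
    by eventually_elim (use r in \<open>auto intro: saddle_D_equation\<close>)
  from has_fps_expansion_cong [OF this refl] lhs
  have "(\<lambda>s. 4 * s * (sinh s + \<i> * of_real c * cosh s)\<^sup>2) has_fps_expansion F^2 * (1 - Z^2)"
    by (rule iffD1)
  from fps_expansion_unique_complex [OF this rhs]
  have eq: "F^2 * (1 - Z^2) = 4 * (fps_X * Y^2)" by (simp only: mult.assoc)
  have Zn: "fps_nth Z 0 = 1" "fps_nth Z 1 = \<i> * c" "fps_nth Z 2 = 1 / 2" "fps_nth Z 3 = \<i> * c / 6"
    and Yn: "fps_nth Y 0 = \<i> * c" "fps_nth Y 1 = 1" "fps_nth Y 2 = \<i> * c / 2"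
    by (simp_all add: Z_def Y_def CH_def SH_def fact_numeral)
  have sq: "fps_nth (G\<^sup>2) 0 = (fps_nth G 0)^2" "fps_nth (G\<^sup>2) 1 = 2 * fps_nth G 0 * fps_nth G 1" "fps_nth (G\<^sup>2) 2 = 2 * fps_nth G 0 * fps_nth G 2 + (fps_nth G 1)\<^sup>2"
    "fps_nth (G\<^sup>2) 3 = 2 * fps_nth G 0 * fps_nth G 3 + 2 * fps_nth G 1 * fps_nth G 2" for G :: "complex fps"
    by (simp_all add: power2_eq_square fps_mult_nth numeral_eq_Suc algebra_simps)
  define W where "W = 1 - Z^2"
  have W: "fps_nth W 0 = 0" "fps_nth W 1 = - 2 * \<i> * c" "fps_nth W 2 = c^2 - 1" "fps_nth W 3 = - 4 * \<i> * c / 3"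
    unfolding W_def fps_sub_nth sq Zn by (simp_all add: power_mult_distrib)
  have nth: "fps_nth (F\<^sup>2 * W) 1 = fps_nth (F\<^sup>2) 0 * fps_nth W 1" "fps_nth (F\<^sup>2 * W) 2 = fps_nth (F\<^sup>2) 1 * fps_nth W 1 + fps_nth (F\<^sup>2) 0 * fps_nth W 2"
    "fps_nth (F\<^sup>2 * W) 3 = fps_nth (F\<^sup>2) 2 * fps_nth W 1 + fps_nth (F\<^sup>2) 1 * fps_nth W 2 + fps_nth (F\<^sup>2) 0 * fps_nth W 3"
    using W(1) by (simp_all add: fps_mult_nth numeral_eq_Suc algebra_simps)
  have rn: "fps_nth (4 * (fps_X * Y^2)) 1 = 4 * fps_nth (Y^2) 0" "fps_nth (4 * (fps_X * Y^2)) 2 = 4 * fps_nth (Y^2) 1" "fps_nth (4 * (fps_X * Y^2)) 3 = 4 * fps_nth (Y^2) 2"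
    by (simp_all add: numeral_fps_const numeral_eq_Suc)
  have d: "d k = fps_nth F k" for k by (simp add: d_def saddle_coeff_def F_def)
  show "d 0 ^ 2 * (- 2 * \<i> * c) = - 4 * c^2"
    using arg_cong [OF eq, of "\<lambda>G. fps_nth G 1"] unfolding W_def [symmetric] nth rn W sq Yn d
    by (simp add: power_mult_distrib)
  show "2 * d 0 * d 1 * (- 2 * \<i> * c) + d 0 ^ 2 * (c^2 - 1) = 8 * \<i> * c"
    using arg_cong [OF eq, of "\<lambda>G. fps_nth G 2"] unfolding W_def [symmetric] nth rn W sq Yn d
    by simp
  show "(2 * d 0 * d 2 + d 1 ^ 2) * (- 2 * \<i> * c) + 2 * d 0 * d 1 * (c^2 - 1) + d 0 ^ 2 * (- 4 * \<i> * c / 3) = 4 * (1 - c^2)"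
  proof -
    have "4 * (2 * (\<i> * c) * (\<i> * c / 2) + 1\<^sup>2) = complex_of_real (4 * (1 - c\<^sup>2))"
      by (simp add: power2_eq_square)
    then show ?thesis
      using arg_cong [OF eq, of "\<lambda>G. fps_nth G 3"] unfolding W_def [symmetric] nth rn W sq Yn d
      by (simp only:)
  qed
qed

lemma saddle_coeff_0:
  assumes c: "c > 0"
  shows "saddle_coeff c 0 = of_real (sqrt (2 * c)) * cis (- pi / 4)"
proof -
  have "csqrt (- \<i> * of_real c / 2) = of_real (sqrt (c / 2)) * cis (- pi / 4)"
  proof (rule csqrt_unique)
    show "(of_real (sqrt (c / 2)) * cis (- pi / 4))\<^sup>2 = - \<i> * of_real c / 2"
    proof -
      have "(cis (- pi / 4))\<^sup>2 = - \<i>"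
        by (simp add: complex_eq_iff Re_power2 Im_power2 cos_45 sin_45 power_divide)
      then show ?thesis
        using c by (simp add: power_mult_distrib flip: of_real_power)
    qed
    show "0 < Re (of_real (sqrt (c / 2)) * cis (- pi / 4)) \<or> Re (of_real (sqrt (c / 2)) * cis (- pi / 4)) = 0 \<and> 0 \<le> Im (of_real (sqrt (c / 2)) * cis (- pi / 4))"
      using c by (simp add: cos_45)
  qed
  moreover have "saddle_coeff c 0 = saddle_D c 0"
    by (simp add: saddle_coeff_def fps_expansion_def)
  ultimately have "saddle_coeff c 0 = 2 * (of_real (sqrt (c / 2)) * cis (- pi / 4))"
    by (simp only: saddle_D_0 [OF c])
  also have "\<dots> = of_real (2 * sqrt (c / 2)) * cis (- pi / 4)"
    by (simp only: of_real_mult of_real_numeral mult.assoc)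
  also have "2 * sqrt (c / 2) = sqrt (2 * c)"
    using c by (simp add: real_sqrt_divide real_sqrt_mult real_div_sqrt field_simps)
  finally show ?thesis .
qed

text \<open>Each equation is linear in the new coefficient. Solving for \<open>d 0 * d k\<close> and
  writing the result as a multiple of \<open>d 0 ^ 2 = - 2 i c\<close> gives the ratio to
  \<open>d 0\<close> without extracting a root.\<close>

lemma saddle_coeff_1_2:
  assumes c: "c > 0"
  shows "saddle_coeff c 1 = saddle_coeff c 0 * (- \<i> * (c^2 + 3) / (4 * c))"
    and "saddle_coeff c 2 = saddle_coeff c 0 * (- (9 * c^4 - 10 * c^2 - 15) / (96 * c^2))"
proof -
  define d where "d = saddle_coeff c"
  note e = saddle_coeff_equations [OF c, folded d_def]
  have c0: "complex_of_real c \<noteq> 0" using c by simp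
  have d00: "d 0 ^ 2 = - 2 * \<i> * c"
    using e(1) c0 by (simp add: field_simps power2_eq_square) (simp add: complex_eq_iff)
  then have d0: "d 0 \<noteq> 0" using c0 by auto
  have d01: "d 0 * d 1 = - (c^2 + 3) / 2"
  proof -
    have "\<i> * complex_of_real c * (4 * (d 0 * d 1) + 2 * (of_real c ^ 2 + 3)) = 0"
      using e(2) unfolding d00 by (simp add: algebra_simps)
    then have "4 * (d 0 * d 1) + 2 * (of_real c ^ 2 + 3) = 0" using c0 by simp
    then have "4 * (d 0 * d 1) = - (2 * (of_real c ^ 2 + 3))" by (simp only: eq_neg_iff_add_eq_0)
    moreover have "d 0 * d 1 = 4 * (d 0 * d 1) / 4" by simp
    ultimately have "d 0 * d 1 = - (2 * (of_real c ^ 2 + 3)) / 4" by (simp only:)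
    also have "- (2 * w) / 4 = - w / 2" for w :: complex by simp
    finally show ?thesis by simp
  qed
  have "d 0 * d 1 = d 0 ^ 2 * (- \<i> * (c^2 + 3) / (4 * c))"
    unfolding d01 d00 using c0 by (simp add: field_simps)
  then have "d 0 * d 1 = d 0 * (d 0 * (- \<i> * (c^2 + 3) / (4 * c)))"
    by (simp only: power2_eq_square mult.assoc)
  then have 1: "d 1 = d 0 * (- \<i> * (c^2 + 3) / (4 * c))"
    by (rule mult_left_cancel [OF d0, THEN iffD1])
  then show "saddle_coeff c 1 = saddle_coeff c 0 * (- \<i> * (c^2 + 3) / (4 * c))" by (simp add: d_def)
  define C where "C = complex_of_real c"
  have C: "C \<noteq> 0" using c0 by (simp add: C_def)
  have t1: "d 1 ^ 2 * (- 2 * \<i> * C) = (C^2 + 3)^2 / 4"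
    unfolding 1 power_mult_distrib d00 using C
    by (simp add: C_def [symmetric] power_mult_distrib power_divide power2_eq_square field_simps)
  have t2: "d 0 ^ 2 * (- 4 * \<i> * C / 3) = - (8 * C^2 / 3)"
    unfolding d00 by (simp add: C_def [symmetric] power2_eq_square)
  have t3: "2 * (d 0 * d 1) = - (C^2 + 3)"
    unfolding d01 by (simp add: C_def)
  have "- 4 * \<i> * C * (d 0 * d 2) + d 1 ^ 2 * (- 2 * \<i> * C) + 2 * (d 0 * d 1) * (C^2 - 1) + d 0 ^ 2 * (- 4 * \<i> * C / 3) = 4 * (1 - C^2)"
    using e(3) by (simp add: C_def algebra_simps)
  then have "- 4 * \<i> * C * (d 0 * d 2) + (C^2 + 3)^2 / 4 + - (C^2 + 3) * (C^2 - 1) + - (8 * C^2 / 3) = 4 * (1 - C^2)"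
    unfolding t1 t2 t3 .
  moreover have "p = y - x + u * v + z" if "p + x + - u * v + - z = y" for p x u v y z :: complex
    using that by (simp add: algebra_simps)
  ultimately have "- 4 * \<i> * C * (d 0 * d 2) = 4 * (1 - C^2) - (C^2 + 3)^2 / 4 + (C^2 + 3) * (C^2 - 1) + 8 * C^2 / 3"
    by blast
  also have "\<dots> = (9 * C^4 - 10 * C^2 - 15) / 12"
    by (simp add: power2_eq_square power4_eq_xxxx field_simps)
  also have "\<dots> = - 4 * \<i> * C * (d 0 ^ 2 * (- (9 * C^4 - 10 * C^2 - 15) / (96 * C^2)))"
    unfolding d00 C_def [symmetric] using C by (simp add: power2_eq_square)
  finally have "- 4 * \<i> * C * (d 0 * d 2) = - 4 * \<i> * C * (d 0 ^ 2 * (- (9 * C^4 - 10 * C^2 - 15) / (96 * C^2)))" .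
  moreover have nz: "- 4 * \<i> * C \<noteq> 0" using C by simp
  ultimately have "d 0 * d 2 = d 0 ^ 2 * (- (9 * C^4 - 10 * C^2 - 15) / (96 * C^2))"
    by (metis mult_left_cancel)
  then have "d 0 * d 2 = d 0 * (d 0 * (- (9 * C^4 - 10 * C^2 - 15) / (96 * C^2)))"
    by (simp only: power2_eq_square mult.assoc)
  then have "d 2 = d 0 * (- (9 * C^4 - 10 * C^2 - 15) / (96 * C^2))"
    by (rule mult_left_cancel [OF d0, THEN iffD1])
  then show "saddle_coeff c 2 = saddle_coeff c 0 * (- (9 * c^4 - 10 * c^2 - 15) / (96 * c^2))"
    by (simp add: d_def C_def)
qed

subsection \<open>The asymptotic expansion\<close>

text \<open>This is the addition formula on the right-hand side, with
  \<open>sin \<beta> = 1/b\<close> and \<open>cos \<beta> = c/b\<close>; the latter explains the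
  choice of \<open>c\<close>.\<close>

lemma sin_complement_saddle_tau:
  fixes b :: real
  assumes b: "b > 1" and "Im (saddle_K (sqrt (b\<^sup>2 - 1)) (u\<^sup>2)) < 0" "norm (saddle_M (sqrt (b\<^sup>2 - 1)) (u\<^sup>2)) < 1"
  shows "sin (of_real (pi / 2) - saddle_tau (sqrt (b\<^sup>2 - 1)) u) / of_real b = sin (of_real (arcsin (1 / b)) + \<i> * u\<^sup>2)"
proof -
  let ?c = "sqrt (b\<^sup>2 - 1)"
  have "cos (arcsin (1 / b)) = sqrt (1 - (1 / b)\<^sup>2)"
    using b by (intro cos_arcsin) (auto simp: field_simps)
  also have "1 - (1 / b)\<^sup>2 = (b\<^sup>2 - 1) / b\<^sup>2" using b by (simp add: field_simps power2_eq_square)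
  also have "sqrt \<dots> = ?c / b" using b by (simp add: real_sqrt_divide)
  finally have cos: "cos (arcsin (1 / b)) = ?c / b" .
  have sin: "sin (arcsin (1 / b)) = 1 / b" using b by (intro sin_arcsin) (auto simp: field_simps)
  have trig: "cos (\<i> * w) = cosh w" "sin (\<i> * w) = \<i> * sinh w" for w :: complex
    by (simp_all add: cosh_conv_cos sinh_conv_sin)
  have half: "sin (of_real (pi / 2) :: complex) = 1" "cos (of_real (pi / 2) :: complex) = 0"
    by (simp_all only: sin_of_real cos_of_real sin_pi_half cos_pi_half of_real_1 of_real_0)
  have "sin (of_real (pi / 2) - saddle_tau ?c u) = cos (saddle_tau ?c u)"
    by (simp only: sin_diff half mult_1_left mult_zero_left diff_zero)
  also have "\<dots> = cosh (u\<^sup>2) + \<i> * of_real ?c * sinh (u\<^sup>2)"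
    by (intro cos_saddle_tau assms)
  finally have "sin (of_real (pi / 2) - saddle_tau ?c u) / of_real b = (cosh (u\<^sup>2) + \<i> * of_real ?c * sinh (u\<^sup>2)) / of_real b"
    by (simp only:)
  also have "\<dots> = sin (of_real (arcsin (1 / b)) + \<i> * u\<^sup>2)"
    by (simp only: sin_add trig sin_of_real cos_of_real sin cos of_real_divide of_real_1) (simp add: add_divide_distrib)
  finally show ?thesis .
qed

text \<open>With \<open>w\<close> the far end of the descent curve, \<open>P (pi/2) - P 0\<close>
  splits at \<open>P w\<close>: one part becomes the Gaussian integral, and the real part of the
  other is exponentially small. The four constants are chosen before \<open>x\<close>.\<close>

lemma quarter_integral_saddle:
  fixes b :: real
  assumes b: "b > 1"
  defines "c \<equiv> sqrt (b\<^sup>2 - 1)" and "\<beta> \<equiv> arcsin (1 / b)"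
  obtains \<epsilon> r \<delta> C where "\<epsilon> > 0" "\<epsilon>\<^sup>2 < r" "\<delta> > 0" "saddle_D c holomorphic_on ball 0 r"
    "\<forall>x>0. \<bar>Re (integral {0..pi/2} (\<lambda>t. exp (\<i> * of_real (x * arcsin (sin t / b)))))
       - Re (exp (\<i> * of_real (x * \<beta>)) * integral {0..\<epsilon>} (\<lambda>v. of_real (exp (- (x * v\<^sup>2))) * saddle_D c (of_real (v\<^sup>2))))\<bar>
       \<le> C * exp (- (\<delta> * x))"
proof -
  have c: "c > 0" using b by (simp add: c_def)
  obtain r where r: "r > 0" "\<And>s. s \<in> ball 0 r \<Longrightarrow> Im (saddle_K c s) < 0" "\<And>s. s \<in> ball 0 r \<Longrightarrow> norm (saddle_M c s) < 1"
    using saddle_radius [OF c] by blast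
  have \<beta>: "0 < \<beta>" "\<beta> < pi / 2"
  proof -
    show "0 < \<beta>" unfolding \<beta>_def using b arcsin_less_arcsin [of 0 "1 / b"] by simp
    have "- 1 < 1 / b" "1 / b < 1" using b by (auto intro: less_trans [of _ 0])
    from arcsin_lt_bounded [OF this] show "\<beta> < pi / 2" unfolding \<beta>_def by simp
  qed
  define T where "T v = of_real (pi / 2) - saddle_tau c (of_real v)" for v :: real
  define F where "F x z = exp (\<i> * of_real x * phase b z)" for x z
  have "isCont (saddle_tau c) 0"
    using has_field_derivative_saddle_tau [of c 0] r by (intro DERIV_isCont) auto
  then have "((\<lambda>u. \<bar>Im (saddle_tau c u)\<bar>) \<longlongrightarrow> \<bar>Im (saddle_tau c 0)\<bar>) (nhds 0)"
    by (auto intro!: tendsto_intros simp: continuous_at tendsto_at_iff_tendsto_nhds)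
  then have "eventually (\<lambda>u. \<bar>Im (saddle_tau c u)\<bar> < arcosh b) (nhds 0)"
    using b by (intro order_tendstoD) (auto simp: saddle_tau_def)
  then obtain e where e: "e > 0" "\<And>u. norm u < e \<Longrightarrow> \<bar>Im (saddle_tau c u)\<bar> < arcosh b"
    by (auto simp: eventually_nhds_metric)
  \<comment> \<open>The first bound keeps the curve in the strip, the second keeps
    \<open>v^2\<close> in the disc of holomorphy; halving makes both strict.\<close>
  define \<epsilon> where "\<epsilon> = min (e / 2) (sqrt r / 2)"
  have eps: "\<epsilon> > 0" "\<epsilon> < e" "\<epsilon> < sqrt r" using e(1) r(1) by (auto simp: \<epsilon>_def min_less_iff_disj)
  have eps2: "\<epsilon>\<^sup>2 < r"
    using power_strict_mono [OF eps(3), of 2] eps(1) r(1) by simp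
  have ball: "(complex_of_real v)\<^sup>2 \<in> ball 0 r" if "v \<in> {0..\<epsilon>}" for v
  proof -
    have "v\<^sup>2 \<le> \<epsilon>\<^sup>2" using that by (intro power_mono) auto
    then show ?thesis using eps2 by (simp add: norm_power)
  qed
  have T_strip: "T v \<in> strip b" if "v \<in> {0..\<epsilon>}" for v
    using e(2) [of "of_real v"] that eps by (auto simp: T_def strip_def)
  have T_phase: "phase b (T v) = of_real \<beta> + \<i> * of_real (v\<^sup>2)" if "v \<in> {0..\<epsilon>}" for v
  proof -
    have "phase b (T v) = Arcsin (sin (of_real \<beta> + \<i> * (of_real v)\<^sup>2))"
      unfolding phase_def T_def c_def \<beta>_def
      using sin_complement_saddle_tau [OF b, of "of_real v"] r(2,3) [OF ball [OF that]]
      by (simp only: c_def)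
    also have "\<dots> = of_real \<beta> + \<i> * of_real (v\<^sup>2)"
      \<comment> \<open>The real part of the argument is \<open>\<beta> < pi/2\<close>, so
        \<open>Arcsin\<close> inverts \<open>sin\<close> on the right branch.\<close>
      using \<beta> by (subst Arcsin_sin) (auto simp: Re_power2)
    finally show ?thesis .
  qed
  have T0: "T 0 = of_real (pi / 2)" by (simp add: T_def saddle_tau_def)
  define w where "w = T \<epsilon>"
  have in_eps: "\<epsilon> \<in> {0..\<epsilon>}" using eps by auto
  have w: "w \<in> strip b" "\<bar>Re w\<bar> < pi / 2" "Im w > 0"
  proof -
    show "w \<in> strip b" unfolding w_def by (rule T_strip [OF in_eps])
    have "0 < Re (saddle_tau c (of_real \<epsilon>))" "Re (saddle_tau c (of_real \<epsilon>)) < pi"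
      using saddle_tau_bounds [of c \<epsilon>] r(2,3) [OF ball [OF in_eps]] eps by auto
    moreover have "Re w = pi / 2 - Re (saddle_tau c (of_real \<epsilon>))" by (simp add: w_def T_def)
    ultimately show Rew: "\<bar>Re w\<bar> < pi / 2" by linarith
    \<comment> \<open>The sign of \<open>Im w\<close> is read off backwards from the known phase
      \<open>\<beta> + i \<epsilon>^2\<close> at the end of the curve.\<close>
    have "sin w = of_real b * sin (phase b w)" using b by (simp add: phase_def)
    then have "cos (Re w) * sinh (Im w) = b * (cos \<beta> * sinh (\<epsilon>\<^sup>2))"
      using T_phase [OF in_eps] by (simp add: w_def Im_sin_sinh [symmetric]) (simp add: Im_sin_sinh)
    moreover have "b * (cos \<beta> * sinh (\<epsilon>\<^sup>2)) > 0"
      using b \<beta> eps by (intro mult_pos_pos cos_gt_zero_pi) auto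
    ultimately have "0 < cos (Re w) * sinh (Im w)" by simp
    moreover have "cos (Re w) > 0" using Rew by (intro cos_gt_zero_pi) auto
    ultimately have "sinh (Im w) > 0" by (simp add: zero_less_mult_iff)
    then show "Im w > 0" by simp
  qed
  obtain \<delta> where \<delta>: "\<delta> > 0"
    "\<And>x P. x > 0 \<Longrightarrow> (\<And>z. z \<in> strip b \<Longrightarrow> (P has_field_derivative F x z) (at z))
       \<Longrightarrow> \<bar>Re (P w - P 0)\<bar> \<le> norm (w - \<i> * of_real (Im w)) * exp (- (\<delta> * x))"
    using contour_remainder [OF b w] unfolding F_def by metis
  have D_hol: "saddle_D c holomorphic_on ball 0 r"
    using r by (intro holomorphic_saddle_D) auto
  show ?thesis
  proof (rule that [OF eps(1) eps2 \<delta>(1) D_hol], intro allI impI)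
    fix x :: real assume x: "x > 0"
    have "F x holomorphic_on strip b"
      unfolding F_def by (intro holomorphic_intros holomorphic_phase b)
    then obtain P where "\<And>z. z \<in> strip b \<Longrightarrow> (P has_field_derivative F x z) (at z within strip b)"
      using holomorphic_convex_primitive' [OF convex_strip open_strip] by blast
    then have P: "(P has_field_derivative F x z) (at z)" if "z \<in> strip b" for z
      using that open_strip by (metis at_within_open)
    have "((\<lambda>t. F x (of_real t)) has_integral (P (of_real (pi / 2)) - P (of_real 0))) {0..pi/2}"
    proof (rule fundamental_theorem_of_calculus)
      fix t
      have "((\<lambda>t. complex_of_real t) has_vector_derivative 1) (at t)"
        by (rule has_vector_derivative_of_real [of "\<lambda>q. q" 1, simplified])
      from field_vector_diff_chain_at [OF this P [OF of_real_in_strip [OF b]]]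
      have "((\<lambda>t. P (of_real t)) has_vector_derivative F x (of_real t)) (at t)"
        by (simp add: o_def)
      then show "((\<lambda>t. P (of_real t)) has_vector_derivative F x (of_real t)) (at t within {0..pi/2})"
        by (rule has_vector_derivative_at_within)
    qed simp
    then have 1: "integral {0..pi/2} (\<lambda>t. exp (\<i> * of_real (x * arcsin (sin t / b)))) = P (of_real (pi / 2)) - P 0"
      by (simp add: F_def phase_of_real [OF b] integral_unique mult.assoc)
    have "((\<lambda>v. - (F x (T v) * saddle_D c (of_real (v\<^sup>2)))) has_integral (P (T \<epsilon>) - P (T 0))) {0..\<epsilon>}"
    proof (rule fundamental_theorem_of_calculus)
      fix v assume v: "v \<in> {0..\<epsilon>}"
      have "(saddle_tau c has_field_derivative saddle_D c ((of_real v)\<^sup>2)) (at (of_real v))"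
        by (intro has_field_derivative_saddle_tau r ball v)
      from field_vector_diff_chain_at [OF has_vector_derivative_of_real [of "\<lambda>q. q" 1, simplified] this]
      have "((\<lambda>v. saddle_tau c (of_real v)) has_vector_derivative saddle_D c ((of_real v)\<^sup>2)) (at v)"
        by (simp add: o_def)
      then have "(T has_vector_derivative 0 - saddle_D c ((of_real v)\<^sup>2)) (at v)"
        unfolding T_def [abs_def] by (intro has_vector_derivative_diff has_vector_derivative_const)
      from field_vector_diff_chain_at [OF this P [OF T_strip [OF v]]]
      have "((\<lambda>v. P (T v)) has_vector_derivative - (F x (T v) * saddle_D c (of_real (v\<^sup>2)))) (at v)"
        by (simp add: o_def mult.commute)
      then show "((\<lambda>v. P (T v)) has_vector_derivative - (F x (T v) * saddle_D c (of_real (v\<^sup>2)))) (at v within {0..\<epsilon>})"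
        by (rule has_vector_derivative_at_within)
    qed (use eps in auto)
    \<comment> \<open>Negation reverses the orientation: \<open>T\<close> starts at
      \<open>pi/2\<close>, whereas the deformed path ends there.\<close>
    from has_integral_neg [OF this]
    have "((\<lambda>v. F x (T v) * saddle_D c (of_real (v\<^sup>2))) has_integral (P (T 0) - P (T \<epsilon>))) {0..\<epsilon>}" by simp
    moreover have "F x (T v) = exp (\<i> * of_real (x * \<beta>)) * of_real (exp (- (x * v\<^sup>2)))" if "v \<in> {0..\<epsilon>}" for v
      unfolding F_def T_phase [OF that] 
      by (simp add: algebra_simps exp_add [symmetric] flip: exp_of_real)
    ultimately have "((\<lambda>v. exp (\<i> * of_real (x * \<beta>)) * (of_real (exp (- (x * v\<^sup>2))) * saddle_D c (of_real (v\<^sup>2)))) has_integral (P (T 0) - P (T \<epsilon>))) {0..\<epsilon>}"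
      by (subst has_integral_cong [where g = "\<lambda>v. F x (T v) * saddle_D c (of_real (v\<^sup>2))"]) (simp_all only: mult.assoc)
    then have 2: "exp (\<i> * of_real (x * \<beta>)) * integral {0..\<epsilon>} (\<lambda>v. of_real (exp (- (x * v\<^sup>2))) * saddle_D c (of_real (v\<^sup>2)))
           = P (of_real (pi / 2)) - P w"
      by (simp only: integral_mult_right [symmetric] integral_unique T0 w_def)
    show "\<bar>Re (integral {0..pi/2} (\<lambda>t. exp (\<i> * of_real (x * arcsin (sin t / b)))))
       - Re (exp (\<i> * of_real (x * \<beta>)) * integral {0..\<epsilon>} (\<lambda>v. of_real (exp (- (x * v\<^sup>2))) * saddle_D c (of_real (v\<^sup>2))))\<bar>
       \<le> norm (w - \<i> * of_real (Im w)) * exp (- (\<delta> * x))"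
      unfolding 1 2 using \<delta>(2) [OF x P] by simp
  qed
qed

text \<open>The factor \<open>cis (pi/4)\<close> is what remains of \<open>exp (i x \<beta>)\<close>
  once the phase \<open>x \<beta> - pi/4\<close> is split off; it also makes the leading coefficient
  real. The minus sign in the sine counterpart comes from the real part of a product.\<close>

definition cos_expansion_coeff :: "real \<Rightarrow> nat \<Rightarrow> real" where
  "cos_expansion_coeff c k = 2 / pi * half_gauss_moment k * Re (saddle_coeff c k * cis (pi / 4))"

definition sin_expansion_coeff :: "real \<Rightarrow> nat \<Rightarrow> real" where
  "sin_expansion_coeff c k = - (2 / pi * half_gauss_moment k * Im (saddle_coeff c k * cis (pi / 4)))"

lemma arg_integral_expansion:
  fixes b :: real
  assumes b: "b > 1"
  shows "has_trig_asymp_expansion (arg_integral b) (arcsin (1 / b)) (cos_expansion_coeff (sqrt (b\<^sup>2 - 1))) (sin_expansion_coeff (sqrt (b\<^sup>2 - 1)))"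
  unfolding has_trig_asymp_expansion_def
proof
  fix N :: nat
  define c where "c = sqrt (b\<^sup>2 - 1)"
  define \<beta> where "\<beta> = arcsin (1 / b)"
  obtain \<epsilon> r \<delta> C where eps: "\<epsilon> > 0" "\<epsilon>\<^sup>2 < r" and \<delta>: "\<delta> > 0" and hol: "saddle_D c holomorphic_on ball 0 r"
    and rem: "\<forall>x>0. \<bar>Re (integral {0..pi/2} (\<lambda>t. exp (\<i> * of_real (x * arcsin (sin t / b)))))
       - Re (exp (\<i> * of_real (x * \<beta>)) * integral {0..\<epsilon>} (\<lambda>v. of_real (exp (- (x * v\<^sup>2))) * saddle_D c (of_real (v\<^sup>2))))\<bar>
       \<le> C * exp (- (\<delta> * x))"
    by (rule quarter_integral_saddle [OF b, folded c_def \<beta>_def]) (rule that; assumption)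
  define J where "J x = integral {0..\<epsilon>} (\<lambda>v. of_real (exp (- (x * v\<^sup>2))) * saddle_D c (of_real (v\<^sup>2)))" for x
  define S where "S x = (\<Sum>k<N. saddle_coeff c k * of_real (half_gauss_moment k * x powr (- real k - 1/2)))" for x
  define Q where "Q x = integral {0..pi/2} (\<lambda>t. exp (\<i> * of_real (x * arcsin (sin t / b))))" for x
  obtain C' where C': "\<And>z. norm z \<le> \<epsilon>\<^sup>2 \<Longrightarrow> norm (saddle_D c z - (\<Sum>k<N. saddle_coeff c k * z ^ k)) \<le> C' * norm z ^ N"
    unfolding saddle_coeff_def using fps_remainder_bound [OF hol _ eps(2)] eps(1) by auto
  have sq_le: "v\<^sup>2 \<le> \<epsilon>\<^sup>2" if "v \<in> {0..\<epsilon>}" for v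
    using that by (intro power_mono) auto
  have J: "(\<lambda>x. J x - S x) \<in> O[at_top](\<lambda>x. of_real (x powr (- real N - 1/2)))"
    unfolding J_def S_def
  proof (rule watson_gauss [OF eps(1)])
    show "continuous_on {0..\<epsilon>} (\<lambda>v. saddle_D c (of_real (v\<^sup>2)))"
    proof (rule continuous_on_compose2 [OF holomorphic_on_imp_continuous_on [OF hol]])
      show "(\<lambda>v. complex_of_real (v\<^sup>2)) ` {0..\<epsilon>} \<subseteq> ball 0 r"
      proof clarify
        fix v assume "v \<in> {0..\<epsilon>}"
        from sq_le [OF this] show "complex_of_real (v\<^sup>2) \<in> ball 0 r" using eps(2) by (simp add: norm_power)
      qed
    qed (intro continuous_intros)
    show "norm (saddle_D c (of_real (v\<^sup>2)) - (\<Sum>k<N. saddle_coeff c k * of_real (v ^ (2 * k)))) \<le> C' * v ^ (2 * N)"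
      if "v \<in> {0..\<epsilon>}" for v
      using C' [of "of_real (v\<^sup>2)"] sq_le [OF that] that by (simp add: norm_power power_mult)
  qed
  then obtain B where B: "eventually (\<lambda>x. norm (J x - S x) \<le> B * norm (complex_of_real (x powr (- real N - 1/2)))) at_top"
    by (rule landau_o.bigE)
  have "(\<lambda>x. C * exp (- (\<delta> * x))) \<in> O[at_top](\<lambda>x. x powr (- real N - 1/2))"
    using \<delta> by real_asymp
  then obtain B' where B': "eventually (\<lambda>x. norm (C * exp (- (\<delta> * x))) \<le> B' * norm (x powr (- real N - 1/2))) at_top"
    by (rule landau_o.bigE)
  have S_eq: "(\<Sum>k<N. (cos_expansion_coeff c k * cos (x * \<beta> - pi/4) + sin_expansion_coeff c k * sin (x * \<beta> - pi/4)) * x powr (- real k - 1/2))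
     = 2 / pi * Re (exp (\<i> * of_real (x * \<beta>)) * S x)" for x
  proof -
    have e: "exp (\<i> * of_real (x * \<beta>)) = cis (x * \<beta> - pi/4) * cis (pi / 4)"
      by (simp only: cis_mult cis_conv_exp [symmetric]) simp
    have rot: "Re (of_real m * (cis y * z)) = (cos y * Re z - sin y * Im z) * m" for m y z
      by simp
    have "Re (exp (\<i> * of_real (x * \<beta>)) * (saddle_coeff c k * of_real m))
       = (cos (x * \<beta> - pi/4) * Re (saddle_coeff c k * cis (pi / 4)) - sin (x * \<beta> - pi/4) * Im (saddle_coeff c k * cis (pi / 4))) * m" for k m
    proof -
      have "exp (\<i> * of_real (x * \<beta>)) * (saddle_coeff c k * of_real m) = of_real m * (cis (x * \<beta> - pi/4) * (saddle_coeff c k * cis (pi / 4)))"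
        unfolding e by (simp only: mult_ac)
      then show ?thesis by (simp only: rot)
    qed
    moreover have "(2 / pi * h * R * C + - (2 / pi * h * I) * S) * p = 2 / pi * ((C * R - S * I) * (h * p))" for h R C I S p :: real
      by (simp add: algebra_simps)
    ultimately show ?thesis
      unfolding S_def sum_distrib_left Re_sum cos_expansion_coeff_def sin_expansion_coeff_def
      by (intro sum.cong refl) (simp only:)
  qed
  have bound: "norm (arg_integral b x - of_real (\<Sum>k<N. (cos_expansion_coeff c k * cos (x * \<beta> - pi/4) + sin_expansion_coeff c k * sin (x * \<beta> - pi/4)) * x powr (- real k - 1/2)))
         \<le> (2 / pi * (B + B')) * norm (complex_of_real (x powr (- real N - 1/2)))"
    if "x > 0" "norm (J x - S x) \<le> B * norm (complex_of_real (x powr (- real N - 1/2)))"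
      "norm (C * exp (- (\<delta> * x))) \<le> B' * norm (x powr (- real N - 1/2))" for x
  proof -
    let ?e = "exp (\<i> * complex_of_real (x * \<beta>))"
    have "arg_integral b x - of_real (\<Sum>k<N. (cos_expansion_coeff c k * cos (x * \<beta> - pi/4) + sin_expansion_coeff c k * sin (x * \<beta> - pi/4)) * x powr (- real k - 1/2))
        = of_real (2 / pi * (Re (Q x) - Re (?e * S x)))"
      unfolding S_eq using arg_integral_eq_quarter [OF b, of x] that(1) by (simp add: Q_def right_diff_distrib)
    then have "norm (arg_integral b x - of_real (\<Sum>k<N. (cos_expansion_coeff c k * cos (x * \<beta> - pi/4) + sin_expansion_coeff c k * sin (x * \<beta> - pi/4)) * x powr (- real k - 1/2)))
        = 2 / pi * \<bar>Re (Q x) - Re (?e * S x)\<bar>"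
      by (simp only: norm_of_real abs_mult) simp
    also have "\<dots> \<le> 2 / pi * ((B + B') * norm (complex_of_real (x powr (- real N - 1/2))))"
    proof (rule mult_left_mono)
      have "\<bar>Re (Q x) - Re (?e * J x)\<bar> \<le> C * exp (- (\<delta> * x))"
        using rem that(1) by (simp only: Q_def J_def)
      also have "\<dots> \<le> B' * norm (complex_of_real (x powr (- real N - 1/2)))"
        using that(3) by (simp only: norm_of_real real_norm_def)
      finally have 1: "\<bar>Re (Q x) - Re (?e * J x)\<bar> \<le> B' * norm (complex_of_real (x powr (- real N - 1/2)))" .
      have "\<bar>Re (?e * J x) - Re (?e * S x)\<bar> = \<bar>Re (?e * (J x - S x))\<bar>"
        by (simp only: right_diff_distrib minus_complex.sel)
      also have "\<dots> \<le> norm (?e * (J x - S x))" by (rule abs_Re_le_cmod)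
      also have "\<dots> = norm (J x - S x)" by (simp only: norm_mult norm_exp_i_times mult_1_left)
      finally have "\<bar>Re (?e * J x) - Re (?e * S x)\<bar> \<le> B * norm (complex_of_real (x powr (- real N - 1/2)))"
        using that(2) by (rule order_trans)
      with 1 show "\<bar>Re (Q x) - Re (?e * S x)\<bar> \<le> (B + B') * norm (complex_of_real (x powr (- real N - 1/2)))"
        unfolding distrib_right by linarith
    qed simp
    finally show ?thesis by (simp only: mult.assoc)
  qed
  have "eventually (\<lambda>x. norm (arg_integral b x - of_real (\<Sum>k<N. (cos_expansion_coeff c k * cos (x * \<beta> - pi/4) + sin_expansion_coeff c k * sin (x * \<beta> - pi/4)) * x powr (- real k - 1/2)))
         \<le> (2 / pi * (B + B')) * norm (complex_of_real (x powr (- real N - 1/2)))) at_top"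
    using B B' eventually_gt_at_top [of "0 :: real"] by eventually_elim (rule bound)
  then show "(\<lambda>x. arg_integral b x - of_real (\<Sum>k<N. (cos_expansion_coeff (sqrt (b\<^sup>2 - 1)) k * cos (x * arcsin (1 / b) - pi/4)
      + sin_expansion_coeff (sqrt (b\<^sup>2 - 1)) k * sin (x * arcsin (1 / b) - pi/4)) * x powr (- real k - 1/2)))
      \<in> O[at_top](\<lambda>x. of_real (x powr (- real N - 1/2)))"
    unfolding c_def \<beta>_def by (rule bigoI)
qed

section \<open>Closed forms of the first three coefficients\<close>

lemma expansion_coeff_values:
  fixes b :: real
  assumes b: "b > 1"
  defines "c \<equiv> sqrt (b\<^sup>2 - 1)"
  shows "cos_expansion_coeff c 0 = 2 / sqrt (2 * pi) * (b\<^sup>2 - 1) powr (1/4)" "sin_expansion_coeff c 0 = 0"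
    "cos_expansion_coeff c 1 = 0" "sin_expansion_coeff c 1 = (b^2 + 2) / (4 * sqrt (2 * pi)) * (b^2 - 1) powr (-1/4)"
    "cos_expansion_coeff c 2 = - ((9 * b^4 - 28 * b^2 + 4) / (64 * sqrt (2 * pi)) * (b^2 - 1) powr (-3/4))"
    "sin_expansion_coeff c 2 = 0"
proof -
  have c: "c > 0" using b by (simp add: c_def)
  have c2: "c\<^sup>2 = b\<^sup>2 - 1" using b by (simp add: c_def)
  have c4: "c ^ 4 = (b\<^sup>2 - 1)\<^sup>2" by (simp add: c2 [symmetric])
  \<comment> \<open>All powers of \<open>b^2 - 1\<close> become powers of \<open>g\<close>: the
    leading coefficient carries \<open>sqrt (2 c)\<close>, and the denominators \<open>c\<close> and
    \<open>c^2\<close> turn \<open>g\<close> into \<open>1/g\<close> and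
    \<open>1/g^3\<close>.\<close>
  define g where "g = sqrt c"
  have g: "g > 0" "g ^ 2 = c" using c by (auto simp: g_def)
  have p: "(b\<^sup>2 - 1) powr (1/4) = g"
  proof -
    have "(b\<^sup>2 - 1) powr (1/4) = ((b\<^sup>2 - 1) powr (1/2)) powr (1/2)" by (simp only: powr_powr) simp
    also have "\<dots> = g" using c b by (simp add: powr_half_sqrt g_def c_def)
    finally show ?thesis .
  qed
  have p1: "(b\<^sup>2 - 1) powr (-1/4) = 1 / g"
    using powr_minus_divide [of "b\<^sup>2 - 1" "1/4"] p by simp
  have p3: "(b\<^sup>2 - 1) powr (-3/4) = 1 / g ^ 3"
  proof -
    have "(b\<^sup>2 - 1) powr (-3/4) = ((b\<^sup>2 - 1) powr (-1/4)) powr 3" by (simp only: powr_powr) simp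
    also have "\<dots> = (1 / g) ^ 3" unfolding p1 using g by (simp add: powr_numeral)
    finally show ?thesis by (simp add: power_divide)
  qed
  have rot: "saddle_coeff c 0 * cis (pi / 4) = of_real (sqrt (2 * c))"
    by (simp add: saddle_coeff_0 [OF c] mult.assoc cis_mult)
  have rot1: "saddle_coeff c 1 * cis (pi / 4) = of_real (sqrt (2 * c)) * (- \<i> * (c^2 + 3) / (4 * c))"
    unfolding saddle_coeff_1_2(1) [OF c] rot [symmetric] by (simp only: mult_ac)
  have rot2: "saddle_coeff c 2 * cis (pi / 4) = of_real (sqrt (2 * c) * (- (9 * c^4 - 10 * c^2 - 15) / (96 * c^2)))"
  proof -
    have "saddle_coeff c 2 * cis (pi / 4) = complex_of_real (sqrt (2 * c)) * (- (9 * c^4 - 10 * c^2 - 15) / (96 * c^2))"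
      unfolding saddle_coeff_1_2(2) [OF c] rot [symmetric] by (simp only: mult_ac)
    then show ?thesis by simp
  qed
  have m: "half_gauss_moment 0 = sqrt pi / 2" "half_gauss_moment 1 = sqrt pi / 4" "half_gauss_moment 2 = 3 * sqrt pi / 8"
    by (simp_all add: half_gauss_moment_def fact_numeral)
  define s where "s = sqrt pi"
  define t where "t = sqrt 2"
  have s: "s > 0" "pi = s ^ 2" by (auto simp: s_def)
  have t: "t > 0" "t ^ 2 = 2" by (auto simp: t_def)
  have sq: "sqrt (2 * pi) = t * s" "sqrt (2 * c) = t * g" by (simp_all add: real_sqrt_mult s_def t_def g_def)
  have t3: "t * t = 2" using t by (simp add: power2_eq_square)
  have i: "of_real (sqrt (2 * c)) * (- \<i> * (c^2 + 3) / (4 * c)) = \<i> * of_real (- (t * g) * (c^2 + 3) / (4 * c))"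
    by (simp add: sq)
  have x0: "cos_expansion_coeff c 0 = 2 / pi * (s / 2) * (t * g)"
    unfolding cos_expansion_coeff_def rot by (simp only: m sq Re_complex_of_real s_def)
  have x1: "sin_expansion_coeff c 1 = 2 / pi * (s / 4) * (t * g * (c\<^sup>2 + 3) / (4 * c))"
    unfolding sin_expansion_coeff_def rot1 i m by (simp add: s_def [symmetric])
  have x2: "cos_expansion_coeff c 2 = 2 / pi * (3 * s / 8) * (t * g * (- (9 * c^4 - 10 * c^2 - 15) / (96 * c^2)))"
    unfolding cos_expansion_coeff_def rot2 by (simp only: m sq Re_complex_of_real s_def)
  have e1: "c\<^sup>2 + 3 = b\<^sup>2 + 2" by (simp add: c2)
  have e2: "9 * c^4 - 10 * c^2 - 15 = 9 * b^4 - 28 * b^2 + 4"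
    unfolding c2 c4 by (simp add: power2_eq_square power4_eq_xxxx algebra_simps)
  have y0: "2 / s\<^sup>2 * (s / 2) * (t * g) = 2 / (t * s) * g"
    and y1: "2 / s\<^sup>2 * (s / 4) * (t * g * y / (4 * g\<^sup>2)) = y / (4 * (t * s)) * (1 / g)"
    and y2: "2 / s\<^sup>2 * (3 * s / 8) * (t * g * (- y / (96 * (g\<^sup>2)\<^sup>2))) = - (y / (64 * (t * s)) * (1 / g ^ 3))" for y
    using s(1) t(1) g(1) t3 by (simp_all add: field_simps power2_eq_square power3_eq_cube)
  show "cos_expansion_coeff c 0 = 2 / sqrt (2 * pi) * (b\<^sup>2 - 1) powr (1/4)"
    unfolding x0 sq p unfolding s(2) by (rule y0)
  show "sin_expansion_coeff c 0 = 0" unfolding sin_expansion_coeff_def rot by simp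
  show "cos_expansion_coeff c 1 = 0" unfolding cos_expansion_coeff_def rot1 i by simp
  show "sin_expansion_coeff c 1 = (b^2 + 2) / (4 * sqrt (2 * pi)) * (b^2 - 1) powr (-1/4)"
    unfolding x1 sq p1 e1 unfolding s(2) g(2) [symmetric] by (rule y1)
  show "cos_expansion_coeff c 2 = - ((9 * b^4 - 28 * b^2 + 4) / (64 * sqrt (2 * pi)) * (b^2 - 1) powr (-3/4))"
    unfolding x2 sq p3 e2 unfolding s(2) g(2) [symmetric] by (rule y2)
  show "sin_expansion_coeff c 2 = 0" unfolding sin_expansion_coeff_def rot2 by simp
qed

theorem theorem3:
  fixes b \<beta> :: real
  assumes "b > 1" and "\<beta> = arcsin (1 / b)"
  shows
    "(\<lambda>x::real. arg_integral b x - of_real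
        (2 / sqrt (2 * pi) * ((b^2 - 1) powr (1/4) / x powr (1/2)) * cos (x * \<beta> - pi/4)
         + (b^2 + 2) / (4 * sqrt (2 * pi)) * ((b^2 - 1) powr (-1/4) / x powr (3/2))
             * sin (x * \<beta> - pi/4)
         - (9 * b^4 - 28 * b^2 + 4) / (64 * sqrt (2 * pi)) * ((b^2 - 1) powr (-3/4) / x powr (5/2))
             * cos (x * \<beta> - pi/4)))
       \<in> O[at_top](\<lambda>x. of_real (1 / x powr (7/2)))
     \<and> (\<exists>p q. has_trig_asymp_expansion (arg_integral b) \<beta> p q
          \<and> p 0 = 2 / sqrt (2 * pi) * (b^2 - 1) powr (1/4) \<and> q 0 = 0
          \<and> p 1 = 0 \<and> q 1 = (b^2 + 2) / (4 * sqrt (2 * pi)) * (b^2 - 1) powr (-1/4)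
          \<and> p 2 = - ((9 * b^4 - 28 * b^2 + 4) / (64 * sqrt (2 * pi)) * (b^2 - 1) powr (-3/4))
          \<and> q 2 = 0)"
proof -
  define c where "c = sqrt (b\<^sup>2 - 1)"
  have exp: "has_trig_asymp_expansion (arg_integral b) \<beta> (cos_expansion_coeff c) (sin_expansion_coeff c)"
    using arg_integral_expansion [OF assms(1)] by (simp only: c_def assms(2))
  note coeffs = expansion_coeff_values [OF assms(1), folded c_def]
  have div: "u * (v / x powr w) = u * v * x powr (- w)" for u v w x :: real
    by (simp add: powr_minus_divide)
  \<comment> \<open>Three terms are kept, so the error exponent is
    \<open>- 3 - 1/2 = - 7/2\<close>.\<close>
  have "(\<lambda>x. arg_integral b x - of_real (\<Sum>k<3. (cos_expansion_coeff c k * cos (x * \<beta> - pi/4) + sin_expansion_coeff c k * sin (x * \<beta> - pi/4))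
           * x powr (- real k - 1/2))) \<in> O[at_top](\<lambda>x. of_real (x powr (- real 3 - 1/2)))"
    using exp unfolding has_trig_asymp_expansion_def by (rule spec)
  moreover have "(\<Sum>k<3. (cos_expansion_coeff c k * cos (x * \<beta> - pi/4) + sin_expansion_coeff c k * sin (x * \<beta> - pi/4)) * x powr (- real k - 1/2))
      = 2 / sqrt (2 * pi) * ((b^2 - 1) powr (1/4) / x powr (1/2)) * cos (x * \<beta> - pi/4)
         + (b^2 + 2) / (4 * sqrt (2 * pi)) * ((b^2 - 1) powr (-1/4) / x powr (3/2)) * sin (x * \<beta> - pi/4)
         - (9 * b^4 - 28 * b^2 + 4) / (64 * sqrt (2 * pi)) * ((b^2 - 1) powr (-3/4) / x powr (5/2)) * cos (x * \<beta> - pi/4)" for x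
  proof -
    have "{..<3 :: nat} = {0, 1, 2}" by auto
    then have "(\<Sum>k<3. (cos_expansion_coeff c k * cos (x * \<beta> - pi/4) + sin_expansion_coeff c k * sin (x * \<beta> - pi/4)) * x powr (- real k - 1/2))
      = (cos_expansion_coeff c 0 * cos (x * \<beta> - pi/4) + sin_expansion_coeff c 0 * sin (x * \<beta> - pi/4)) * x powr (- (1/2))
        + (cos_expansion_coeff c 1 * cos (x * \<beta> - pi/4) + sin_expansion_coeff c 1 * sin (x * \<beta> - pi/4)) * x powr (- (3/2))
        + (cos_expansion_coeff c 2 * cos (x * \<beta> - pi/4) + sin_expansion_coeff c 2 * sin (x * \<beta> - pi/4)) * x powr (- (5/2))"
      by simp
    then show ?thesis unfolding coeffs div by (simp only: add.assoc) (simp add: mult_ac)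
  qed
  moreover have "x powr (- real 3 - 1/2) = 1 / x powr (7/2)" for x :: real
    by (simp add: powr_minus_divide [symmetric])
  ultimately have "(\<lambda>x::real. arg_integral b x - of_real
        (2 / sqrt (2 * pi) * ((b^2 - 1) powr (1/4) / x powr (1/2)) * cos (x * \<beta> - pi/4)
         + (b^2 + 2) / (4 * sqrt (2 * pi)) * ((b^2 - 1) powr (-1/4) / x powr (3/2))
             * sin (x * \<beta> - pi/4)
         - (9 * b^4 - 28 * b^2 + 4) / (64 * sqrt (2 * pi)) * ((b^2 - 1) powr (-3/4) / x powr (5/2))
             * cos (x * \<beta> - pi/4)))
       \<in> O[at_top](\<lambda>x. of_real (1 / x powr (7/2)))"
    by (simp only:)
  then show ?thesis using exp coeffs by blast
qed

end
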